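(* Let $X$ and $Y$ be two real Banach spaces and let $\Omega_0:X\times Y\to\mathbb R$ be a bounded non-degenerate bilinear form. Let $T:X\leadsto Y$ be a linear Fredholm relation with index $0$ that is skew-adjoint with respect to $\Omega_0$. Then there is a $\delta>0$ such that for each bounded non-degenerate bilinear form $\Omega:X\times Y\to\mathbb R$ and each closed linear relation $S:X\leadsto Y$ that is skew symmetric with respect to $\Omega$ and satisfies $\hat\delta(S,T)+\|L_\Omega-L_{\Omega_0}\|<\delta$, the relation $S$ is a Fredholm relation with index $0$ that is skew-adjoint with respect to $\Omega$, and $$\dim\ker S\equiv\dim\ker T \pmod 2.$$
   Context: A bilinear form $\Omega:X\times Y\to\mathbb R$ is non-degenerate if $\Omega(x,\cdot)=0$ implies $x=0$ and $\Omega(\cdot,y)=0$ implies $y=0$. If $\Omega$ is bounded, $L_\Omega:X\to Y^*$ is the bounded linear map $(L_\Omega x)(y)=\Omega(x,y)$. A linear relation $A:X\leadsto Y$ is a linear subspace $A\subset X\times Y$; $\ker A=\{x:(x,0)\in A\}$, $\operatorname{im}A=\{y:\exists x,\ (x,y)\in A\}$. It is closed if it is closed in $X\times Y$. A closed linear relation $A$ is Fredholm if $\dim\ker A<\infty$, $\operatorname{im}A$ is closed and $\dim Y/\operatorname{im}A<\infty$; then its index is $\dim\ker A-\dim Y/\operatorname{im}A$. The $\Omega$-adjoint of $A$ is $A^\Omega:=\{(x',y')\in X\times Y:\ \Omega(x,y')=\Omega(x',y)\ \forall (x,y)\in A\}$. Put $(-1)\circ A:=\{(x,-y):(x,y)\in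 A\}$. $A$ is skew symmetric with respect to $\Omega$ if $(-1)\circ A\subset A^\Omega$, and skew-adjoint with respect to $\Omega$ if $(-1)\circ A=A^\Omega$. $\hat\delta$ is the gap between closed subspaces of $X\times Y$: $\hat\delta(M,N)=\max\{\delta(M,N),\delta(N,M)\}$, $\delta(M,N)=\sup_{u\in M,\|u\|=1}\operatorname{dist}(u,N)$ ($=0$ if $M=\{0\}$), with the norm $\|(x,y)\|=(\|x\|^2+\|y\|^2)^{1/2}$. *)

theory Defs
  imports "HOL-Analysis.Analysis" "HOL-Number_Theory.Cong"
begin

definition nondegenerate :: "('a::real_vector \<Rightarrow> 'b::real_vector \<Rightarrow> real) \<Rightarrow> bool" where
  "nondegenerate \<Omega> \<longleftrightarrow>
     (\<forall>x. (\<forall>y. \<Omega> x y = 0) \<longrightarrow> x = 0) \<and> (\<forall>y. (\<forall>x. \<Omega> x y = 0) \<longrightarrow> y = 0)"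

(* Meaningful only if bounded_bilinear \<Omega> holds; otherwise Blinfun is applied outside its domain. *)
definition form_map ::
    "('a::real_normed_vector \<Rightarrow> 'b::real_normed_vector \<Rightarrow> real) \<Rightarrow> 'a \<Rightarrow>\<^sub>L 'b \<Rightarrow>\<^sub>L real" where
  "form_map \<Omega> = Blinfun (\<lambda>x. Blinfun (\<lambda>y. \<Omega> x y))"

lemma form_map_apply:
  assumes "bounded_bilinear \<Omega>"
  shows "blinfun_apply (blinfun_apply (form_map \<Omega>) x) y = \<Omega> x y"
proof -
  interpret bounded_bilinear \<Omega> by fact
  have 1: "Blinfun (\<lambda>y. \<Omega> x y) = prod_right x" for x
    by (simp add: prod_right.abs_eq)
  have "form_map \<Omega> = Blinfun prod_right"
    by (simp add: form_map_def 1)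
  then show ?thesis
    by (simp add: bounded_linear_Blinfun_apply bounded_linear_prod_right)
qed

(* A linear relation from 'a to 'b is a set A :: ('a \<times> 'b) set with subspace A. *)

definition rel_ker :: "('a::real_vector \<times> 'b::real_vector) set \<Rightarrow> 'a set" where
  "rel_ker A = {x. (x, 0) \<in> A}"

definition rel_im :: "('a::real_vector \<times> 'b::real_vector) set \<Rightarrow> 'b set" where
  "rel_im A = {y. \<exists>x. (x, y) \<in> A}"

(* The library function dim is 0 on spaces without a finite basis, so finiteness of the
   dimension has to be required separately. *)
definition finite_dim :: "'a::real_vector set \<Rightarrow> bool" where
  "finite_dim V \<longleftrightarrow> (\<exists>B. finite B \<and> span B = V)"

(* The classes of the elements of B in the quotient of 'a by the subspace V form a finite basis
   of that quotient: two vectors have the same class iff their difference lies in V. *)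
definition quotient_basis :: "'a::real_vector set \<Rightarrow> 'a set \<Rightarrow> bool" where
  "quotient_basis V B \<longleftrightarrow> finite B \<and>
     (\<forall>c. (\<Sum>b\<in>B. c b *\<^sub>R b) \<in> V \<longrightarrow> (\<forall>b\<in>B. c b = 0)) \<and>
     (\<forall>y. \<exists>c. y - (\<Sum>b\<in>B. c b *\<^sub>R b) \<in> V)"

definition finite_codim :: "'a::real_vector set \<Rightarrow> bool" where
  "finite_codim V \<longleftrightarrow> (\<exists>B. quotient_basis V B)"

definition codim :: "'a::real_vector set \<Rightarrow> nat" where
  "codim V = (THE n. \<exists>B. quotient_basis V B \<and> card B = n)"

lemma quotient_basis_card_le:
  assumes V: "subspace V" and B: "quotient_basis V B" and C: "quotient_basis V C"
  shows "card B \<le> card C"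
proof -
  have finB: "finite B" and finC: "finite C"
    using B C by (auto simp: quotient_basis_def)
  have indB: "\<And>c b. (\<Sum>b\<in>B. c b *\<^sub>R b) \<in> V \<Longrightarrow> b \<in> B \<Longrightarrow> c b = 0"
    using B by (auto simp: quotient_basis_def)
  have "\<forall>y. \<exists>c. y - (\<Sum>b\<in>C. c b *\<^sub>R b) \<in> V"
    using C by (auto simp: quotient_basis_def)
  then obtain k where k: "\<And>y. y - (\<Sum>b\<in>C. k y b *\<^sub>R b) \<in> V"
    by metis
  define p where "p y = (\<Sum>b\<in>C. k y b *\<^sub>R b)" for y
  have pV: "y - p y \<in> V" for y
    using k by (simp add: p_def)
  have zero: "c b = 0" if "(\<Sum>b\<in>B. c b *\<^sub>R p b) = 0" "b \<in> B" for c b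
  proof -
    have "(\<Sum>b\<in>B. c b *\<^sub>R (b - p b)) \<in> V"
      by (intro subspace_sum[OF V] subspace_scale[OF V] pV)
    then have "(\<Sum>b\<in>B. c b *\<^sub>R b) \<in> V"
      using that(1) by (simp add: scaleR_diff_right sum_subtractf)
    then show ?thesis
      using indB that(2) by blast
  qed
  have inj: "inj_on p B"
  proof (rule inj_onI, rule ccontr)
    fix a b assume ab: "a \<in> B" "b \<in> B" "p a = p b" "a \<noteq> b"
    define c :: "'a \<Rightarrow> real" where "c x = (if x = a then 1 else if x = b then -1 else 0)" for x
    have "(\<Sum>x\<in>B. c x *\<^sub>R p x) = (\<Sum>x\<in>{a, b}. c x *\<^sub>R p x)"
      by (rule sum.mono_neutral_right) (use ab finB in \<open>auto simp: c_def\<close>)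
    also have "\<dots> = 0"
      using ab by (simp add: c_def)
    finally have "c a = 0"
      using zero ab(1) by blast
    then show False
      by (simp add: c_def)
  qed
  have "independent (p ` B)"
    unfolding dependent_finite[OF finite_imageI[OF finB]]
  proof (intro notI, elim exE conjE bexE)
    fix u v assume u: "v \<in> p ` B" "u v \<noteq> 0" "(\<Sum>v\<in>p ` B. u v *\<^sub>R v) = 0"
    then have "(\<Sum>b\<in>B. u (p b) *\<^sub>R p b) = 0"
      by (simp add: sum.reindex[OF inj])
    then show False
      using zero[of "\<lambda>b. u (p b)"] u by auto
  qed
  moreover have "p ` B \<subseteq> span C"
    by (auto simp: p_def intro: span_sum span_scale span_base)
  ultimately have "card (p ` B) \<le> card C"
    using independent_span_bound[OF finC] by blast
  then show ?thesis
    by (simp add: card_image[OF inj])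
qed

lemma codim_eq_card:
  assumes "subspace V" "quotient_basis V B"
  shows "codim V = card B"
  unfolding codim_def
  by (rule the_equality) (use assms quotient_basis_card_le in \<open>blast intro: le_antisym\<close>)+

definition fredholm_relation ::
    "('a::real_normed_vector \<times> 'b::real_normed_vector) set \<Rightarrow> bool" where
  "fredholm_relation A \<longleftrightarrow> subspace A \<and> closed A \<and>
     finite_dim (rel_ker A) \<and> closed (rel_im A) \<and> finite_codim (rel_im A)"

definition fredholm_index ::
    "('a::real_normed_vector \<times> 'b::real_normed_vector) set \<Rightarrow> int" where
  "fredholm_index A = int (dim (rel_ker A)) - int (codim (rel_im A))"

definition form_adjoint ::
    "('a \<Rightarrow> 'b \<Rightarrow> real) \<Rightarrow> ('a \<times> 'b) set \<Rightarrow> ('a \<times> 'b) set" where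
  "form_adjoint \<Omega> A = {(x', y'). \<forall>(x, y)\<in>A. \<Omega> x y' = \<Omega> x' y}"

definition neg_relation :: "('a \<times> 'b::real_vector) set \<Rightarrow> ('a \<times> 'b) set" where
  "neg_relation A = {(x, - y) | x y. (x, y) \<in> A}"

definition skew_symmetric_wrt ::
    "('a \<Rightarrow> 'b::real_vector \<Rightarrow> real) \<Rightarrow> ('a \<times> 'b) set \<Rightarrow> bool" where
  "skew_symmetric_wrt \<Omega> A \<longleftrightarrow> neg_relation A \<subseteq> form_adjoint \<Omega> A"

definition skew_adjoint_wrt ::
    "('a \<Rightarrow> 'b::real_vector \<Rightarrow> real) \<Rightarrow> ('a \<times> 'b) set \<Rightarrow> bool" where
  "skew_adjoint_wrt \<Omega> A \<longleftrightarrow> neg_relation A = form_adjoint \<Omega> A"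

(* Below, these are used on the product type, whose library norm is
   norm (x, y) = sqrt ((norm x)^2 + (norm y)^2). *)
definition semigap :: "'a::real_normed_vector set \<Rightarrow> 'a set \<Rightarrow> real" where
  "semigap M N = (if M = {0} then 0 else SUP u\<in>{u \<in> M. norm u = 1}. infdist u N)"

definition gap :: "'a::real_normed_vector set \<Rightarrow> 'a set \<Rightarrow> real" where
  "gap M N = max (semigap M N) (semigap N M)"

end

theory Submission
  imports Defs
begin

text \<open>
  Let \<open>e\<^sub>1, \<dots>, e\<^sub>n\<close> be a basis of \<open>ker T\<close>. Since \<open>T\<close> is skew-adjoint of index 0, a complement \<open>Z\<close> of \<open>im T\<close> has
  a basis \<open>z\<^sub>1, \<dots>, z\<^sub>n\<close> dual to it under \<open>\<Omega>\<^sub>0\<close>, and then the bordered map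
  \<open>((x, y), z) \<mapsto> (y + z, \<Sum>\<^sub>i \<Omega>\<^sub>0(x, z\<^sub>i) z\<^sub>i)\<close> is a bijection \<open>T \<times> Z \<rightarrow> Y \<times> Z\<close> with bounded inverse.
  Bijectivity survives small changes of \<open>T\<close> (in the gap) and of \<open>\<Omega>\<^sub>0\<close>; no complement of \<open>T\<close> in
  \<open>X \<times> Y\<close> is needed. For \<open>S\<close> and \<open>\<Omega>\<close> it implies that \<open>P = {(x, y) \<in> S. y \<in> Z}\<close> has dimension \<open>n\<close> and that
  the form \<open>((x, y), (x', y')) \<mapsto> \<Omega>(x, y')\<close>, which is alternating on \<open>P\<close>, has radical \<open>ker S \<times> {0}\<close>.
  Alternating forms have even rank, hence the parity. Functionals on \<open>P\<close> vanishing on the radical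
  are represented by the form, which gives \<open>im S = (ker S)\<^sup>\<bottom>\<close>; closedness of the image, index 0 and
  skew-adjointness follow from this equality.
\<close>

subsection \<open>Finite-dimensional forms\<close>

text \<open>A two-sided Gram-Schmidt step: a new vector and a vector it pairs with are both
  corrected against the dual pairs already found. It serves for \<open>ker T\<close> with
  \<open>Z\<close> a complement of \<open>im T\<close>, and for \<open>ker S\<close> with
  \<open>Z = UNIV\<close>.\<close>

lemma dual_basis_exists:
  fixes \<Omega> :: "'a::real_vector \<Rightarrow> 'b::real_vector \<Rightarrow> real"
  assumes bil: "bilinear \<Omega>" and Z: "subspace Z"
    and "finite B" "independent B"
    and "\<And>x. x \<in> span B \<Longrightarrow> (\<forall>z\<in>Z. \<Omega> x z = 0) \<Longrightarrow> x = 0"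
  shows "\<exists>d. \<forall>b\<in>B. d b \<in> Z \<and> (\<forall>a\<in>B. \<Omega> a (d b) = (if a = b then 1 else 0))"
  using assms(3-)
proof (induction B rule: finite_induct)
  case empty
  then show ?case by simp
next
  case (insert e B)
  have lin1: "linear (\<lambda>x. \<Omega> x y)" and lin2: "linear (\<Omega> x)" for x y
    using bil by (auto simp: bilinear_def)
  note sm = linear_diff[OF lin1] linear_diff[OF lin2] linear_sum[OF lin1] linear_sum[OF lin2]
    linear_scale[OF lin1] linear_scale[OF lin2]
  have "independent B"
    using insert.prems(1) by (rule independent_mono) auto
  moreover have "x = 0" if "x \<in> span B" "\<forall>z\<in>Z. \<Omega> x z = 0" for x
    using that span_mono[of B "insert e B"] by (intro insert.prems(2)) auto
  ultimately have "\<exists>d. \<forall>b\<in>B. d b \<in> Z \<and> (\<forall>a\<in>B. \<Omega> a (d b) = (if a = b then 1 else 0))"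
    by (rule insert.IH)
  then obtain d where d: "\<And>b. b \<in> B \<Longrightarrow> d b \<in> Z"
      "\<And>a b. a \<in> B \<Longrightarrow> b \<in> B \<Longrightarrow> \<Omega> a (d b) = (if a = b then 1 else 0)"
    by metis
  \<comment> \<open>\<open>x\<close> is \<open>e\<close> made orthogonal to all \<open>d b\<close>.
    It lies in the new span and is nonzero by independence, so some \<open>z\<close> in
    \<open>Z\<close> detects it.\<close>
  define x where "x = e - (\<Sum>b\<in>B. \<Omega> e (d b) *\<^sub>R b)"
  have "x \<in> span (insert e B)"
    unfolding x_def by (intro span_diff span_sum span_scale span_base) auto
  moreover have "x \<noteq> 0"
  proof
    assume "x = 0"
    then have "e = (\<Sum>b\<in>B. \<Omega> e (d b) *\<^sub>R b)"
      by (simp add: x_def)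
    then have "e \<in> span B"
      by (metis (no_types, lifting) span_base span_scale span_sum)
    then show False
      using insert.prems(1) insert.hyps(2) by (simp add: independent_insert)
  qed
  ultimately obtain z where z: "z \<in> Z" "\<Omega> x z \<noteq> 0"
    using insert.prems(2) by blast
  have xd: "\<Omega> x (d b) = 0" if "b \<in> B" for b
  proof -
    have "(\<Sum>a\<in>B. \<Omega> e (d a) * \<Omega> a (d b)) = (\<Sum>a\<in>B. if a = b then \<Omega> e (d a) else 0)"
      by (rule sum.cong) (use d(2) that in auto)
    then show ?thesis
      using that insert.hyps(1) by (simp add: x_def sm)
  qed
  \<comment> \<open>Now \<open>z\<close> is made orthogonal to \<open>B\<close>. The two corrections
    do not interfere: \<open>\<Omega> e z' = \<Omega> x z' = \<Omega> x z\<close>.\<close>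
  define z' where "z' = z - (\<Sum>b\<in>B. \<Omega> b z *\<^sub>R d b)"
  have z'Z: "z' \<in> Z"
    unfolding z'_def by (intro subspace_diff subspace_sum subspace_scale Z z d)
  have bz': "\<Omega> b z' = 0" if "b \<in> B" for b
  proof -
    have "(\<Sum>a\<in>B. \<Omega> a z * \<Omega> b (d a)) = (\<Sum>a\<in>B. if a = b then \<Omega> a z else 0)"
      by (rule sum.cong) (use d(2) that in auto)
    then show ?thesis
      using that insert.hyps(1) by (simp add: z'_def sm)
  qed
  have "\<Omega> x z' = \<Omega> x z"
    by (simp add: z'_def sm xd)
  moreover have "\<Omega> x z' = \<Omega> e z'"
    by (simp add: x_def sm bz')
  ultimately have ez': "\<Omega> e z' \<noteq> 0"
    using z by simp
  define w where "w = (1 / \<Omega> e z') *\<^sub>R z'"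
  have w: "w \<in> Z" "\<Omega> e w = 1" "\<And>b. b \<in> B \<Longrightarrow> \<Omega> b w = 0"
    using ez' bz' z'Z Z by (auto simp: w_def sm subspace_scale)
  \<comment> \<open>The old dual vectors must also annihilate \<open>e\<close>; subtracting
    multiples of \<open>w\<close> achieves this and leaves their values on \<open>B\<close>
    unchanged.\<close>
  define d' where "d' b = (if b = e then w else d b - \<Omega> e (d b) *\<^sub>R w)" for b
  have "\<forall>b\<in>insert e B. d' b \<in> Z \<and> (\<forall>a\<in>insert e B. \<Omega> a (d' b) = (if a = b then 1 else 0))"
    using w d Z insert.hyps(2) by (auto simp: d'_def sm intro!: subspace_diff subspace_scale)
  then show ?case
    by blast
qed

lemma finite_dim_subspace:
  assumes "finite_dim P" "subspace Q" "Q \<subseteq> P"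
  obtains B where "finite B" "independent B" "span B = Q" "card B = dim Q"
proof -
  obtain C where C: "finite C" "span C = P"
    using assms(1) by (auto simp: finite_dim_def)
  obtain B where B: "B \<subseteq> Q" "independent B" "Q \<subseteq> span B" "card B = dim Q"
    using basis_exists by blast
  show thesis
  proof (rule that[of B])
    show "finite B"
      using independent_span_bound[OF C(1) B(2)] B(1) C(2) assms(3) by blast
    show "span B = Q"
      using B(1,3) assms(2) by (simp add: span_minimal subset_antisym)
  qed fact+
qed

text \<open>The image of a basis of \<open>P\<close> is independent in the span of a finite set,
  hence finite. Finiteness is thus transported back along \<open>g\<close> together with the
  dimension.\<close>

lemma finite_dim_linear_inj_on:
  assumes "linear g" "inj_on g P" "subspace P" "g ` P = span C" "finite C"
  shows "finite_dim P" "dim P = dim (span C)"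
proof -
  obtain B where B: "B \<subseteq> P" "independent B" "P \<subseteq> span B" "card B = dim P"
    using basis_exists by blast
  have sB: "span B = P"
    using B assms(3) by (simp add: span_minimal subset_antisym)
  have ind: "independent (g ` B)"
    using linear_independent_injective_image[OF assms(1) B(2)] assms(2) sB by simp
  have img: "span (g ` B) = span C"
    using linear_span_image[OF assms(1)] sB assms(4) by simp
  have inj: "inj_on g B"
    using assms(2) B(1) inj_on_subset by blast
  have "finite (g ` B)"
    using independent_span_bound[OF assms(5) ind] img span_superset[of "g ` B"] by simp
  then have "finite B"
    using inj finite_imageD by blast
  then show "finite_dim P"
    using sB by (auto simp: finite_dim_def)
  have "dim (span C) = card (g ` B)"
    using img ind by (metis dim_eq_card_independent dim_span)
  then show "dim P = dim (span C)"
    using B(4) inj by (simp add: card_image)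
qed

text \<open>Induction on the dimension by splitting off a hyperbolic plane: its orthogonal
  complement in \<open>P\<close> has dimension two less and the same radical. Both the parity and
  the representation of functionals pass from the complement to \<open>P\<close>.\<close>

lemma alternating_form_radical:
  fixes \<beta> :: "'v::real_vector \<Rightarrow> 'v \<Rightarrow> real"
  assumes bil: "bilinear \<beta>" and "finite_dim P" and "\<And>u. u \<in> P \<Longrightarrow> \<beta> u u = 0"
  defines "rad \<equiv> \<lambda>P. {u \<in> P. \<forall>v\<in>P. \<beta> u v = 0}"
  shows "[dim (rad P) = dim P] (mod 2) \<and>
    (\<forall>L. linear L \<and> (\<forall>r\<in>rad P. L r = 0) \<longrightarrow> (\<exists>s\<in>P. \<forall>v\<in>P. L v = \<beta> v s))"
  using assms(2,3)
proof (induction "dim P" arbitrary: P rule: less_induct)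
  case less
  have lin1: "linear (\<lambda>x. \<beta> x y)" and lin2: "linear (\<beta> x)" for x y
    using bil by (auto simp: bilinear_def)
  note sm = linear_diff[OF lin1] linear_diff[OF lin2] linear_add[OF lin1] linear_add[OF lin2]
    linear_scale[OF lin1] linear_scale[OF lin2] linear_0[OF lin1] linear_0[OF lin2]
  have P: "subspace P"
    using less.prems(1) by (auto simp: finite_dim_def)
  have skew: "\<beta> v u = - \<beta> u v" if "u \<in> P" "v \<in> P" for u v
    using less.prems(2)[of "u + v"] less.prems(2)[of u] less.prems(2)[of v] that P
    by (simp add: sm subspace_add)
  show ?case
  proof (cases "\<forall>u\<in>P. \<forall>v\<in>P. \<beta> u v = 0")
    case True
    then have "rad P = P"
      by (auto simp: rad_def)
    then show ?thesis
      using True subspace_0[OF P] by auto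
  next
    case False
    then obtain u v0 where uv0: "u \<in> P" "v0 \<in> P" "\<beta> u v0 \<noteq> 0"
      by blast
    define v where "v = (1 / \<beta> u v0) *\<^sub>R v0"
    have uv: "u \<in> P" "v \<in> P" "\<beta> u v = 1" "\<beta> v u = - 1" "\<beta> u u = 0" "\<beta> v v = 0"
      using uv0 P less.prems(2) skew[of u v] by (auto simp: v_def sm subspace_scale)
    define Q where "Q = {w \<in> P. \<beta> u w = 0 \<and> \<beta> v w = 0}"
    have Q: "subspace Q" "Q \<subseteq> P"
      using P by (auto simp: Q_def subspace_def sm)
    \<comment> \<open>Projection onto \<open>Q\<close> along \<open>u\<close> and \<open>v\<close>;
      the signs come from \<open>\<beta> u v = 1\<close> and
      \<open>\<beta> v u = -1\<close>.\<close>
    have proj: "w + \<beta> v w *\<^sub>R u - \<beta> u w *\<^sub>R v \<in> Q" if "w \<in> P" for w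
      using that uv P by (simp add: Q_def sm subspace_add subspace_diff subspace_scale)
    obtain B where B: "finite B" "independent B" "span B = Q" "card B = dim Q"
      using finite_dim_subspace[OF less.prems(1) Q] by blast
    have v: "v \<notin> span B"
      using uv B(3) by (auto simp: Q_def)
    have u: "u \<notin> span (insert v B)"
    proof
      assume "u \<in> span (insert v B)"
      then obtain k where "u - k *\<^sub>R v \<in> Q"
        using B(3) by (auto simp: span_insert)
      then have "\<beta> v (u - k *\<^sub>R v) = 0"
        by (simp add: Q_def)
      then show False
        using uv by (simp add: sm)
    qed
    have ind: "independent (insert u (insert v B))"
      using u v B(2) by (simp add: independent_insertI)
    have "span (insert u (insert v B)) = P"
    proof (intro subset_antisym span_minimal P subsetI)
      show "w \<in> P" if "w \<in> insert u (insert v B)" for w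
        using that uv Q(2) B(3) span_base by blast
      show "w \<in> span (insert u (insert v B))" if "w \<in> P" for w
      proof -
        let ?w = "w + \<beta> v w *\<^sub>R u - \<beta> u w *\<^sub>R v"
        have "?w \<in> span (insert u (insert v B))"
          using proj[OF that] B(3) span_mono[of B "insert u (insert v B)"] by blast
        moreover have "u \<in> span (insert u (insert v B))" "v \<in> span (insert u (insert v B))"
          by (auto intro: span_base)
        ultimately have "?w - \<beta> v w *\<^sub>R u + \<beta> u w *\<^sub>R v \<in> span (insert u (insert v B))"
          by (meson span_add span_diff span_scale)
        then show ?thesis
          by simp
      qed
    qed
    moreover have "v \<notin> B" "u \<notin> insert v B"
      using u v span_superset[of B] span_superset[of "insert v B"] by blast+
    ultimately have "dim P = card (insert u (insert v B))"
      using dim_span_eq_card_independent[OF ind] by simp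
    also have "\<dots> = dim Q + 2"
      using B(1,4) \<open>v \<notin> B\<close> \<open>u \<notin> insert v B\<close> by simp
    finally have dimP: "dim P = dim Q + 2" .
    \<comment> \<open>Elements of \<open>Q\<close> are orthogonal to \<open>u\<close> and
      \<open>v\<close> by definition, so orthogonality to \<open>Q\<close> extends to all of
      \<open>P\<close> through the projection.\<close>
    have radQ: "rad Q = rad P"
    proof (intro subset_antisym subsetI)
      fix r assume "r \<in> rad Q"
      then have r: "r \<in> P" "\<beta> r u = 0" "\<beta> r v = 0" "\<And>w. w \<in> Q \<Longrightarrow> \<beta> r w = 0"
        using skew[of u r] skew[of v r] uv by (auto simp: rad_def Q_def)
      have "\<beta> r w = 0" if "w \<in> P" for w
        using r(4)[OF proj[OF that]] r(2,3) by (simp add: sm)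
      then show "r \<in> rad P"
        using r(1) by (simp add: rad_def)
    next
      fix r assume "r \<in> rad P"
      then show "r \<in> rad Q"
        using skew[of u r] skew[of v r] uv skew[of r u] skew[of r v] by (auto simp: rad_def Q_def)
    qed
    have "finite_dim Q"
      using B by (auto simp: finite_dim_def)
    then have IH: "[dim (rad Q) = dim Q] (mod 2)"
      "\<And>L. linear L \<Longrightarrow> (\<forall>r\<in>rad Q. L r = 0) \<Longrightarrow> \<exists>s\<in>Q. \<forall>v\<in>Q. L v = \<beta> v s"
      using less.hyps[of Q] less.prems(2) Q dimP by auto
    have "\<exists>s\<in>P. \<forall>w\<in>P. L w = \<beta> w s" if L: "linear L" "\<forall>r\<in>rad P. L r = 0" for L
    proof -
      obtain s where s: "s \<in> Q" "\<And>w. w \<in> Q \<Longrightarrow> L w = \<beta> w s"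
        using IH(2) L radQ by metis
      \<comment> \<open>\<open>s\<close> represents \<open>L\<close> on \<open>Q\<close> and is
        orthogonal to \<open>u\<close> and \<open>v\<close>; the added terms produce the values
        \<open>L u\<close> and \<open>L v\<close> and vanish when paired with
        \<open>Q\<close>.\<close>
      define t where "t = s - L v *\<^sub>R u + L u *\<^sub>R v"
      have tP: "t \<in> P"
        using s(1) Q(2) uv P by (auto simp: t_def subspace_add subspace_diff subspace_scale)
      have "L w = \<beta> w t" if w: "w \<in> P" for w
      proof -
        have su: "\<beta> u s = 0" "\<beta> v s = 0"
          using s(1) by (auto simp: Q_def)
        have "L (w + \<beta> v w *\<^sub>R u - \<beta> u w *\<^sub>R v) = \<beta> (w + \<beta> v w *\<^sub>R u - \<beta> u w *\<^sub>R v) s"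
          by (rule s(2)[OF proj[OF w]])
        then have "L w + \<beta> v w * L u - \<beta> u w * L v = \<beta> w s"
          by (simp add: sm su linear_add[OF L(1)] linear_diff[OF L(1)] linear_scale[OF L(1)])
        then show ?thesis
          using skew[OF uv(1) w] skew[OF uv(2) w] by (simp add: t_def sm algebra_simps)
      qed
      then show ?thesis
        using tP by blast
    qed
    moreover have "[dim (rad P) = dim P] (mod 2)"
      using IH(1) radQ dimP by (simp add: cong_def)
    ultimately show ?thesis
      by blast
  qed
qed

subsection \<open>Bounded inverses and their perturbation\<close>

text \<open>The correction step of the open mapping theorem: iterating an approximate solution
  operator that halves the error.\<close>

lemma iterated_approximation:
  fixes f :: "'a::banach \<Rightarrow> 'b::real_normed_vector"
  assumes f: "bounded_linear f" and D: "subspace D" "closed D" and W: "subspace W" "f ` D \<subseteq> W"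
    and C: "0 \<le> C"
    and approx: "\<And>w. w \<in> W \<Longrightarrow> \<exists>d\<in>D. norm d \<le> C * norm w \<and> norm (w - f d) \<le> norm w / 2"
    and w: "w \<in> W"
  shows "\<exists>d\<in>D. f d = w \<and> norm d \<le> 2 * C * norm w"
proof -
  obtain g where g: "\<And>w. w \<in> W \<Longrightarrow> g w \<in> D" "\<And>w. w \<in> W \<Longrightarrow> norm (g w) \<le> C * norm w"
      "\<And>w. w \<in> W \<Longrightarrow> norm (w - f (g w)) \<le> norm w / 2"
    using approx by metis
  \<comment> \<open>\<open>r n\<close> is the error left after \<open>n\<close> corrections, and
    \<open>g (r n)\<close> is the next correction.\<close>
  define r where "r n = ((\<lambda>v. v - f (g v)) ^^ n) w" for n
  have r0: "r 0 = w" and rS: "r (Suc n) = r n - f (g (r n))" for n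
    by (simp_all add: r_def)
  have rW: "r n \<in> W" for n
  proof (induction n)
    case (Suc n)
    then show ?case
      using W g(1)[OF Suc] by (auto simp: rS intro!: subspace_diff)
  qed (simp add: r0 w)
  have rn: "norm (r n) \<le> norm w * (1/2) ^ n" for n
  proof (induction n)
    case (Suc n)
    then show ?case
      using g(3)[OF rW[of n]] by (simp add: rS)
  qed (simp add: r0)
  have geo: "(\<lambda>n. C * norm w * (1/2) ^ n) sums (C * norm w * 2)"
    using sums_mult[OF geometric_sums[of "1/2::real"], of "C * norm w"] by simp
  have gn: "norm (g (r n)) \<le> C * norm w * (1/2) ^ n" for n
    using g(2)[OF rW[of n]] mult_left_mono[OF rn C] by (metis mult.assoc order_trans)
  have "summable (\<lambda>n. norm (g (r n)))"
    by (rule summable_comparison_test'[OF sums_summable[OF geo], of 0]) (use gn in simp)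
  then have sg: "summable (\<lambda>n. g (r n))"
    and nsg: "norm (\<Sum>n. g (r n)) \<le> (\<Sum>n. norm (g (r n)))"
    and sng: "summable (\<lambda>n. norm (g (r n)))"
    by (auto intro: summable_norm_cancel summable_norm)
  define d where "d = (\<Sum>n. g (r n))"
  have "(\<lambda>n. \<Sum>i<n. g (r i)) \<longlonglongrightarrow> d"
    using summable_LIMSEQ[OF sg] by (simp add: d_def)
  moreover have "(\<Sum>i<n. g (r i)) \<in> D" for n
    by (intro subspace_sum D g rW)
  ultimately have dD: "d \<in> D"
    using closed_sequentially[OF D(2), of "\<lambda>n. \<Sum>i<n. g (r i)"] by blast
  have "r \<longlonglongrightarrow> 0"
  proof (rule Lim_null_comparison)
    show "\<forall>\<^sub>F n in sequentially. norm (r n) \<le> norm w * (1/2) ^ n"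
      using rn by simp
    show "(\<lambda>n. norm w * (1/2) ^ n) \<longlonglongrightarrow> 0"
      by (intro tendsto_mult_right_zero LIMSEQ_power_zero) simp
  qed
  \<comment> \<open>The images of the corrections are differences of successive errors, so their
    series telescopes to \<open>w\<close>.\<close>
  then have "(\<lambda>n. r n - r (Suc n)) sums (w - 0)"
    using telescope_sums'[of r 0] by (simp add: r0)
  then have "(\<lambda>n. f (g (r n))) sums w"
    by (simp add: rS)
  moreover have "(\<lambda>n. f (g (r n))) sums f d"
    using bounded_linear.sums[OF f summable_sums[OF sg]] by (simp add: d_def)
  ultimately have "f d = w"
    using sums_unique2 by blast
  moreover have "norm d \<le> 2 * C * norm w"
    using nsg suminf_le[OF gn sng sums_summable[OF geo]] sums_unique[OF geo]
    by (simp add: d_def mult_ac)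
  ultimately show ?thesis
    using dD by blast
qed

lemma bounded_inverse_on:
  fixes f :: "'a::banach \<Rightarrow> 'b::banach"
  assumes f: "bounded_linear f" and D: "subspace D" "closed D" and W: "closed (f ` D)"
    and inj: "inj_on f D"
  obtains C where "0 < C" "\<And>d. d \<in> D \<Longrightarrow> norm d \<le> C * norm (f d)"
proof -
  interpret f: bounded_linear f by fact
  define W where "W = f ` D"
  have sW: "subspace W"
    unfolding W_def using D(1) f.linear by (simp add: linear_subspace_image)
  define V where "V k = {w. \<exists>d\<in>D. norm d \<le> real k \<and> f d = w}" for k :: nat
  have VW: "V k \<subseteq> W" for k
    by (auto simp: V_def W_def)
  have clV: "closure (V k) \<subseteq> W" for k
    using VW W by (simp add: W_def closure_minimal)
  have UV: "W = (\<Union>k. closure (V k))"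
  proof (intro subset_antisym subsetI)
    fix w assume "w \<in> W"
    then obtain d where "d \<in> D" "w = f d"
      by (auto simp: W_def)
    moreover obtain k where "norm d \<le> real k"
      using real_arch_simple by blast
    ultimately have "w \<in> V k"
      by (auto simp: V_def)
    then show "w \<in> (\<Union>k. closure (V k))"
      using closure_subset by blast
  qed (use clV in blast)
  \<comment> \<open>Baire's theorem in the subspace topology of \<open>W\<close>, which is
    completely metrizable because \<open>W\<close> is closed. The closures stay inside
    \<open>W\<close> and cover it.\<close>
  have "\<exists>k. top_of_set W interior_of closure (V k) \<noteq> {}"
  proof (rule ccontr)
    assume "\<not> ?thesis"
    then have "top_of_set W interior_of \<Union>(range (\<lambda>k. closure (V k))) = {}"
      using clV W
      by (intro Baire_category_alt disjI1)
        (auto simp: W_def closedin_closed_eq subset_iff completely_metrizable_space_closedin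
          completely_metrizable_space_euclidean)
    then have "W = {}"
      using UV by (metis interior_of_topspace topspace_euclidean_subtopology)
    then show False
      using subspace_0[OF sW] by blast
  qed
  then obtain k w0 where "w0 \<in> top_of_set W interior_of closure (V k)"
    by blast
  then obtain U where U: "openin (top_of_set W) U" "w0 \<in> U" "U \<subseteq> closure (V k)"
    by (auto simp: interior_of_def)
  then have w0: "w0 \<in> W" and "\<exists>e>0. ball w0 e \<inter> W \<subseteq> U"
    unfolding openin_contains_ball by blast+
  then obtain e where e: "0 < e" "ball w0 e \<inter> W \<subseteq> U"
    by blast
  define r where "r = e / 2"
  have r: "0 < r" "cball w0 r \<inter> W \<subseteq> closure (V k)"
    using e U(3) by (auto simp: r_def subset_iff)
  \<comment> \<open>A difference of two elements of norm at most \<open>k\<close> has norm at most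
    \<open>2 * k\<close>; it handles a right-hand side of norm \<open>r\<close>, and scaling gives
    the factor \<open>1 / r\<close>.\<close>
  define C where "C = 2 * real k / r"
  have C: "0 \<le> C"
    using r by (simp add: C_def)
  have approx: "\<exists>d\<in>D. norm d \<le> C * norm w \<and> norm (w - f d) \<le> norm w / 2" if w: "w \<in> W" for w
  proof (cases "w = 0")
    case True
    then show ?thesis
      using subspace_0[OF D(1)] by (intro bexI[of _ 0]) (auto simp: f.zero)
  next
    case False
    \<comment> \<open>After rescaling \<open>w\<close> to norm \<open>r\<close>, both
      \<open>w0 + a *\<^sub>R w\<close> and \<open>w0\<close> lie in the ball. Approximating each
      within \<open>r / 4\<close> and subtracting leaves an error of at most \<open>r / 2\<close>,
      which scales back to half of \<open>norm w\<close>.\<close>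
    define a where "a = r / norm w"
    have a: "0 < a" "a * norm w = r"
      using False r by (auto simp: a_def)
    have "w0 + a *\<^sub>R w \<in> closure (V k)"
      using w0 w sW a r(2) by (auto simp: subset_iff dist_norm subspace_add subspace_scale)
    then obtain v1 where "v1 \<in> V k" "dist v1 (w0 + a *\<^sub>R w) < r / 4"
      using closure_approachableD[of _ _ "r/4"] r(1) by (metis dist_commute divide_pos_pos zero_less_numeral)
    then obtain d1 where d1: "d1 \<in> D" "norm d1 \<le> k" "norm (w0 + a *\<^sub>R w - f d1) < r / 4"
      by (auto simp: V_def dist_norm norm_minus_commute)
    have "w0 \<in> closure (V k)"
      using w0 r by (auto simp: subset_iff)
    then obtain v2 where "v2 \<in> V k" "dist v2 w0 < r / 4"
      using closure_approachableD[of _ _ "r/4"] r(1) by (metis dist_commute divide_pos_pos zero_less_numeral)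
    then obtain d2 where d2: "d2 \<in> D" "norm d2 \<le> k" "norm (w0 - f d2) < r / 4"
      by (auto simp: V_def dist_norm norm_minus_commute)
    define d where "d = (1 / a) *\<^sub>R (d1 - d2)"
    have "norm (a *\<^sub>R w - f (d1 - d2)) = norm ((w0 + a *\<^sub>R w - f d1) - (w0 - f d2))"
      by (simp add: f.diff algebra_simps)
    also have "\<dots> \<le> r / 2"
      using norm_triangle_ineq4[of "w0 + a *\<^sub>R w - f d1" "w0 - f d2"] d1 d2 by simp
    finally have "(1 / a) * norm (a *\<^sub>R w - f (d1 - d2)) \<le> (1 / a) * (r / 2)"
      using a(1) by (intro mult_left_mono) auto
    then have "norm ((1 / a) *\<^sub>R (a *\<^sub>R w - f (d1 - d2))) \<le> (r / 2) / a"
      using a(1) by simp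
    also have "(1 / a) *\<^sub>R (a *\<^sub>R w - f (d1 - d2)) = w - f d"
      using a(1) by (simp add: d_def f.scaleR f.diff scaleR_diff_right)
    also have "(r / 2) / a = norm w / 2"
      using a by (simp add: field_simps)
    finally have "norm (w - f d) \<le> norm w / 2" .
    moreover have "norm d \<le> C * norm w"
    proof -
      have "norm (d1 - d2) \<le> 2 * real k"
        using norm_triangle_ineq4[of d1 d2] d1 d2 by simp
      then have "norm d \<le> 2 * real k / a"
        using a(1) by (simp add: d_def divide_right_mono)
      also have "\<dots> = C * norm w"
        using r(1) False by (simp add: C_def a_def)
      finally show ?thesis .
    qed
    moreover have "d \<in> D"
      using d1 d2 D(1) by (simp add: d_def subspace_diff subspace_scale)
    ultimately show ?thesis
      by blast
  qed
  show thesis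
  \<comment> \<open>The summand 1 keeps the constant positive when \<open>k = 0\<close>.\<close>
  proof (rule that[of "2 * C + 1"])
    show "0 < 2 * C + 1"
      using C by simp
    show "norm d \<le> (2 * C + 1) * norm (f d)" if d: "d \<in> D" for d
    proof -
      have "f d \<in> W"
        using d by (simp add: W_def)
      then obtain d' where d': "d' \<in> D" "f d' = f d" "norm d' \<le> 2 * C * norm (f d)"
        using iterated_approximation[OF f D sW _ C approx] by (metis W_def order_refl)
      then have "d' = d"
        using inj d by (auto dest: inj_onD)
      then show ?thesis
        using d' norm_ge_zero[of "f d"] by (simp add: algebra_simps del: norm_ge_zero)
    qed
  qed
qed

text \<open>Both the map and its domain move. Approximating \<open>D\<close> by \<open>D0\<close>
  carries the lower bound for \<open>f0\<close> over to \<open>f\<close> and gives injectivity;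
  approximating \<open>D0\<close> by \<open>D\<close> turns exact solutions for \<open>f0\<close>
  into approximate ones for \<open>f\<close>, which the iteration improves to exact ones.\<close>

lemma bij_betw_perturbation:
  fixes f f0 :: "'a::banach \<Rightarrow> 'b::real_normed_vector"
  assumes f0: "bounded_linear f0" and f: "bounded_linear f"
    and D: "subspace D" "closed D" and W: "subspace W" "f ` D \<subseteq> W" "f0 ` D0 = W"
    and C: "0 \<le> C" "\<And>d. d \<in> D0 \<Longrightarrow> norm d \<le> C * norm (f0 d)"
    and K: "0 \<le> K" "\<And>x. norm (f0 x) \<le> K * norm x"
    and near: "\<And>x. norm (f x - f0 x) \<le> \<epsilon> * norm x"
    and DD0: "\<And>d. d \<in> D \<Longrightarrow> \<exists>e\<in>D0. norm (d - e) \<le> \<epsilon> * norm d"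
    and D0D: "\<And>d. d \<in> D0 \<Longrightarrow> \<exists>e\<in>D. norm (d - e) \<le> \<epsilon> * norm d"
    and \<epsilon>: "0 \<le> \<epsilon>" "\<epsilon> * (1 + (K + 2) * C) \<le> 1 / 2"
  shows "bij_betw f D W"
proof -
  interpret f0: bounded_linear f0 by fact
  interpret f: bounded_linear f by fact
  have \<epsilon>1: "\<epsilon> \<le> 1 / 2" "\<epsilon> * ((K + 2) * C) \<le> 1 / 2 - \<epsilon>"
  proof -
    have "0 \<le> \<epsilon> * ((K + 2) * C)"
      using \<epsilon>(1) C(1) K(1) by simp
    then show "\<epsilon> \<le> 1 / 2" "\<epsilon> * ((K + 2) * C) \<le> 1 / 2 - \<epsilon>"
      using \<epsilon>(2) by (simp_all add: distrib_left)
  qed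
  \<comment> \<open>A nearby \<open>e\<close> in \<open>D0\<close> has a small image under
    \<open>f0\<close>, so \<open>norm e \<le> (1 / 2 - \<epsilon>) * norm d\<close>. Together with
    the distance from \<open>e\<close> to \<open>d\<close> this gives
    \<open>norm d \<le> norm d / 2\<close>.\<close>
  have zero: "d = 0" if d: "d \<in> D" "f d = 0" for d
  proof -
    obtain e where e: "e \<in> D0" "norm (d - e) \<le> \<epsilon> * norm d"
      using DD0 d(1) by blast
    have "norm (f0 e) = norm (f0 d - f0 (d - e))"
      by (simp add: f0.diff)
    also have "\<dots> \<le> norm (f0 d) + K * norm (d - e)"
      using norm_triangle_ineq4 K(2) by (meson add_left_mono order_trans)
    also have "norm (f0 d) \<le> \<epsilon> * norm d"
      using near[of d] d(2) by simp
    also have "K * norm (d - e) \<le> K * (\<epsilon> * norm d)"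
      using e(2) K(1) by (rule mult_left_mono)
    finally have "norm (f0 e) \<le> (K + 1) * \<epsilon> * norm d"
      by (simp add: algebra_simps)
    then have "norm e \<le> C * ((K + 1) * \<epsilon> * norm d)"
      using C(2)[OF e(1)] mult_left_mono[OF _ C(1)] by (meson order_trans)
    also have "\<dots> \<le> (\<epsilon> * ((K + 2) * C)) * norm d"
      using C(1) \<epsilon>(1) by (simp add: algebra_simps)
    also have "\<dots> \<le> (1 / 2 - \<epsilon>) * norm d"
      using \<epsilon>1(2) by (rule mult_right_mono) simp
    finally have "norm e \<le> (1 / 2 - \<epsilon>) * norm d" .
    moreover have "norm d \<le> norm e + norm (d - e)"
      using norm_triangle_ineq[of e "d - e"] by simp
    ultimately have "norm d \<le> norm d / 2"
      using e(2) unfolding left_diff_distrib by linarith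
    then show ?thesis
      by simp
  qed
  have inj: "inj_on f D"
  proof (rule inj_onI)
    fix x y assume "x \<in> D" "y \<in> D" "f x = f y"
    then show "x = y"
      using zero[of "x - y"] D(1) by (simp add: f.diff subspace_diff)
  qed
  \<comment> \<open>Solve exactly with \<open>f0\<close> on \<open>D0\<close>, then replace the
    solution by a nearby element of \<open>D\<close>. The change of argument costs
    \<open>K * \<epsilon>\<close> and the change of map \<open>2 * \<epsilon>\<close>, both relative
    to \<open>norm e\<close>.\<close>
  have approx: "\<exists>d\<in>D. norm d \<le> (2 * C) * norm w \<and> norm (w - f d) \<le> norm w / 2" if w: "w \<in> W" for w
  proof -
    obtain e where e: "e \<in> D0" "f0 e = w"
      using W(3) w by blast
    obtain d where d: "d \<in> D" "norm (e - d) \<le> \<epsilon> * norm e"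
      using D0D e(1) by blast
    have eC: "norm e \<le> C * norm w"
      using C(2)[OF e(1)] e(2) by simp
    have "\<epsilon> * norm e \<le> 1 * norm e"
      using \<epsilon>1(1) by (intro mult_right_mono) auto
    then have d2: "norm d \<le> 2 * norm e"
      using d(2) norm_triangle_ineq[of e "d - e"] by (simp add: norm_minus_commute)
    have "norm (w - f d) = norm (f0 (e - d) - (f d - f0 d))"
      by (simp add: f0.diff e(2))
    also have "\<dots> \<le> K * norm (e - d) + \<epsilon> * norm d"
      using norm_triangle_ineq4 K(2) near by (meson add_mono order_trans)
    also have "\<dots> \<le> K * (\<epsilon> * norm e) + \<epsilon> * (2 * norm e)"
      using d d2 K(1) \<epsilon>(1) by (intro add_mono mult_left_mono)
    also have "\<dots> = \<epsilon> * (K + 2) * norm e"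
      by (simp add: algebra_simps)
    also have "\<dots> \<le> \<epsilon> * (K + 2) * (C * norm w)"
      using eC K(1) \<epsilon>(1) by (intro mult_left_mono) auto
    also have "\<dots> = (\<epsilon> * ((K + 2) * C)) * norm w"
      by simp
    also have "\<dots> \<le> (1 / 2) * norm w"
      using \<epsilon>1(2) \<epsilon>(1) by (intro mult_right_mono) auto
    finally show ?thesis
      using d(1) d2 eC by (intro bexI[of _ d]) auto
  qed
  have "W \<subseteq> f ` D"
  proof
    fix w assume "w \<in> W"
    then obtain d where "d \<in> D" "f d = w"
      using iterated_approximation[OF f D W(1,2) _ approx] C(1) by fastforce
    then show "w \<in> f ` D"
      by blast
  qed
  then show ?thesis
    using inj W(2) by (auto simp: bij_betw_def)
qed

section \<open>Approximation of vectors in terms of the gap\<close>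

text \<open>Since \<open>0 \<in> N\<close>, distances of unit vectors to \<open>N\<close> are at
  most 1, so the supremum is over a bounded set.\<close>

lemma infdist_le_semigap:
  assumes "subspace N" "e \<in> M" "norm e = 1"
  shows "infdist e N \<le> semigap M N"
proof -
  have "bdd_above ((\<lambda>u. infdist u N) ` {u \<in> M. norm u = 1})"
  proof (rule bdd_aboveI2)
    show "infdist u N \<le> 1" if "u \<in> {u \<in> M. norm u = 1}" for u
      using infdist_le[OF subspace_0[OF assms(1)], of u] that by simp
  qed
  then have "infdist e N \<le> (SUP u\<in>{u \<in> M. norm u = 1}. infdist u N)"
    using assms by (intro cSUP_upper) auto
  moreover have "M \<noteq> {0}"
    using assms by auto
  ultimately show ?thesis
    by (simp add: semigap_def)
qed

text \<open>Lets the distance of the forms be bounded by the sum of gap and distance.\<close>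

lemma semigap_nonneg:
  assumes "subspace M" "subspace N"
  shows "0 \<le> semigap M N"
proof (cases "M = {0}")
  case False
  then obtain u where u: "u \<in> M" "u \<noteq> 0"
    using subspace_0[OF assms(1)] by blast
  then have "0 \<le> infdist ((1 / norm u) *\<^sub>R u) N" "(1 / norm u) *\<^sub>R u \<in> M"
    using assms(1) by (auto simp: infdist_nonneg subspace_scale)
  then show ?thesis
    using infdist_le_semigap[OF assms(2), of "(1 / norm u) *\<^sub>R u" M] u by simp
qed (simp add: semigap_def)

text \<open>The distance to \<open>N\<close> may not be attained, but the strict inequality leaves
  room for some \<open>v\<close> within \<open>\<epsilon>\<close> of the normalized vector; scaling
  back by \<open>norm u\<close> gives the claim.\<close>

lemma gap_approximation:
  assumes "subspace M" "subspace N" "semigap M N < \<epsilon>" "u \<in> M"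
  shows "\<exists>v\<in>N. norm (u - v) \<le> \<epsilon> * norm u"
proof (cases "u = 0")
  case True
  then show ?thesis
    using subspace_0[OF assms(2)] by force
next
  case False
  define e where "e = (1 / norm u) *\<^sub>R u"
  have e: "e \<in> M" "norm e = 1"
    using False assms(1,4) by (auto simp: e_def subspace_scale)
  have "(INF v\<in>N. dist e v) < \<epsilon>"
    using infdist_le_semigap[OF assms(2) e] assms(3) subspace_0[OF assms(2)]
    by (subst infdist_notempty[symmetric]) auto
  then obtain v where v: "v \<in> N" "dist e v < \<epsilon>"
    using cINF_less_iff[of N "dist e" \<epsilon>] subspace_0[OF assms(2)] by auto
  have "norm (u - norm u *\<^sub>R v) = norm (norm u *\<^sub>R (e - v))"
    using False by (simp add: e_def scaleR_diff_right)
  also have "\<dots> \<le> \<epsilon> * norm u"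
    using v(2) by (simp add: dist_norm mult.commute[of \<epsilon>] mult_left_mono)
  finally show ?thesis
    using subspace_scale[OF assms(2) v(1)] by blast
qed

subsection \<open>Bordering a skew symmetric relation\<close>

text \<open>The functionals \<open>\<Omega>(x, d b)\<close> are encoded as coefficients of the \<open>d b\<close>, so that the second component
  takes values in the span of the \<open>d b\<close> and all spaces are subspaces of products of \<open>X\<close> and \<open>Y\<close>.\<close>

definition bordered ::
    "('a \<Rightarrow> 'b::real_vector \<Rightarrow> real) \<Rightarrow> 'a set \<Rightarrow> ('a \<Rightarrow> 'b) \<Rightarrow> ('a \<times> 'b) \<times> 'b \<Rightarrow> 'b \<times> 'b" where
  "bordered \<Omega> B d = (\<lambda>((x, y), z). (y + z, \<Sum>b\<in>B. \<Omega> x (d b) *\<^sub>R d b))"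

section \<open>Annihilators, kernels and images\<close>

lemma bounded_bilinear_imp_bilinear:
  "bounded_bilinear \<Omega> \<Longrightarrow> bilinear \<Omega>"
  unfolding bilinear_def
  by (intro conjI allI bounded_linear.linear bounded_bilinear.bounded_linear_left
      bounded_bilinear.bounded_linear_right)

text \<open>The map \<open>y \<mapsto> y - (\<Sum>a\<in>E. \<Omega> a y *\<^sub>R w a)\<close>
  projects onto the annihilator of \<open>E\<close> along the span of the dual vectors, so these
  represent a basis of the quotient. For \<open>E\<close> a basis of \<open>ker S\<close> this
  computes the codimension of \<open>im S\<close>; the coordinate formula is also used for the
  border.\<close>

lemma quotient_basis_annihilator:
  fixes \<Omega> :: "'a::real_vector \<Rightarrow> 'b::real_vector \<Rightarrow> real"
  assumes bil: "bilinear \<Omega>" and fin: "finite E"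
    and dual: "\<And>a b. a \<in> E \<Longrightarrow> b \<in> E \<Longrightarrow> \<Omega> a (w b) = (if a = b then 1 else 0)"
  shows "quotient_basis {y. \<forall>x\<in>span E. \<Omega> x y = 0} (w ` E)" "card (w ` E) = card E"
    "\<And>y x. x \<in> span E \<Longrightarrow> \<Omega> x (y - (\<Sum>a\<in>E. \<Omega> a y *\<^sub>R w a)) = 0"
    "\<And>c a. a \<in> E \<Longrightarrow> \<Omega> a (\<Sum>b\<in>E. c b *\<^sub>R w b) = c a"
proof -
  have lin1: "linear (\<lambda>x. \<Omega> x y)" and lin2: "linear (\<Omega> x)" for x y
    using bil by (auto simp: bilinear_def)
  note sm = linear_diff[OF lin1] linear_diff[OF lin2] linear_sum[OF lin1] linear_sum[OF lin2]
    linear_scale[OF lin1] linear_scale[OF lin2]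
  show coef: "\<Omega> a (\<Sum>b\<in>E. c b *\<^sub>R w b) = c a" if a: "a \<in> E" for a c
  proof -
    have "\<Omega> a (\<Sum>b\<in>E. c b *\<^sub>R w b) = (\<Sum>b\<in>E. if b = a then c b else 0)"
      unfolding sm by (rule sum.cong) (use a dual in auto)
    then show ?thesis
      using a fin by simp
  qed
  show resid: "\<Omega> x (y - (\<Sum>a\<in>E. \<Omega> a y *\<^sub>R w a)) = 0" if "x \<in> span E" for x y
    using that
  proof (induction rule: span_induct_alt)
    case base
    then show ?case
      using linear_0[OF lin1] by simp
  next
    case (step c a x)
    have "\<Omega> a (y - (\<Sum>a\<in>E. \<Omega> a y *\<^sub>R w a)) = 0"
      using coef[OF step(1), of "\<lambda>a. \<Omega> a y"] by (simp add: linear_diff[OF lin2])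
    then show ?case
      using step(2) by (simp add: linear_add[OF lin1] linear_scale[OF lin1])
  qed
  have inj: "inj_on w E"
    using dual by (metis inj_onI zero_neq_one)
  then show "card (w ` E) = card E"
    by (rule card_image)
  show "quotient_basis {y. \<forall>x\<in>span E. \<Omega> x y = 0} (w ` E)"
    unfolding quotient_basis_def
  proof (intro conjI allI impI)
    show "finite (w ` E)"
      using fin by simp
    show "\<forall>b\<in>w ` E. c b = 0" if "(\<Sum>b\<in>w ` E. c b *\<^sub>R b) \<in> {y. \<forall>x\<in>span E. \<Omega> x y = 0}" for c
    proof
      fix b assume "b \<in> w ` E"
      then obtain a where a: "a \<in> E" "b = w a"
        by blast
      have "\<Omega> a (\<Sum>b\<in>E. c (w b) *\<^sub>R w b) = 0"
        using that span_base[OF a(1)] by (simp add: sum.reindex[OF inj])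
      then show "c b = 0"
        using coef[OF a(1), of "\<lambda>b. c (w b)"] a by simp
    qed
    show "\<exists>c. y - (\<Sum>b\<in>w ` E. c b *\<^sub>R b) \<in> {y. \<forall>x\<in>span E. \<Omega> x y = 0}" for y
    proof
      let ?c = "\<lambda>b. \<Omega> (inv_into E w b) y"
      have "(\<Sum>b\<in>w ` E. ?c b *\<^sub>R b) = (\<Sum>a\<in>E. \<Omega> a y *\<^sub>R w a)"
        by (simp add: sum.reindex[OF inj] inv_into_f_f[OF inj])
      then show "y - (\<Sum>b\<in>w ` E. ?c b *\<^sub>R b) \<in> {y. \<forall>x\<in>span E. \<Omega> x y = 0}"
        using resid by simp
    qed
  qed
qed

lemma rel_ker_subspace:
  assumes "subspace A"
  shows "subspace (rel_ker A)"
proof -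
  have "linear (\<lambda>x. (x, 0))"
    by (rule linearI) auto
  then have "subspace ((\<lambda>x. (x, 0)) -` A)"
    using assms by (rule linear_subspace_vimage)
  moreover have "(\<lambda>x. (x, 0)) -` A = rel_ker A"
    by (auto simp: rel_ker_def)
  ultimately show ?thesis
    by simp
qed

lemma rel_im_subspace:
  assumes "subspace A"
  shows "subspace (rel_im A)"
proof -
  have "linear snd"
    by (rule linearI) auto
  then have "subspace (snd ` A)"
    using assms by (rule linear_subspace_image)
  moreover have "rel_im A = snd ` A"
    by (force simp: rel_im_def)
  ultimately show ?thesis
    by simp
qed

text \<open>The pointwise form of skew symmetry. With both pairs equal it shows that
  \<open>\<Omega> x y = 0\<close> on the relation, which makes the induced form alternating.\<close>

lemma skew_symmetric_wrtD:
  assumes "skew_symmetric_wrt \<Omega> S" "bilinear \<Omega>" "(x, y) \<in> S" "(x', y') \<in> S"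
  shows "\<Omega> x y' = - \<Omega> x' y"
proof -
  have "(x', - y') \<in> form_adjoint \<Omega> S"
    using assms(1,4) by (auto simp: skew_symmetric_wrt_def neg_relation_def)
  then have "\<Omega> x (- y') = \<Omega> x' y"
    using assms(3) by (auto simp: form_adjoint_def)
  then show ?thesis
    by (simp add: bilinear_rneg[OF assms(2)])
qed

section \<open>Consequences of a bijective bordered map\<close>

text \<open>Applied to the perturbed relation. Here \<open>B\<close> is an index set for the border
  vectors, since duality of \<open>B\<close> and \<open>d\<close> under \<open>\<Omega>0\<close>
  does not in general persist under \<open>\<Omega>\<close>; bijectivity takes its place.\<close>

lemma bordered_skew_fredholm:
  fixes \<Omega> :: "'a::real_normed_vector \<Rightarrow> 'b::real_normed_vector \<Rightarrow> real"
  assumes bb: "bounded_bilinear \<Omega>" and nd: "nondegenerate \<Omega>"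
    and S: "subspace S" "closed S" "skew_symmetric_wrt \<Omega> S"
    and fin: "finite B"
    and d: "inj_on d B" "independent (d ` B)"
    and bij: "bij_betw (bordered \<Omega> B d) (S \<times> span (d ` B)) (UNIV \<times> span (d ` B))"
  shows "fredholm_relation S \<and> fredholm_index S = 0 \<and> skew_adjoint_wrt \<Omega> S \<and>
    [dim (rel_ker S) = card B] (mod 2)"
proof -
  have bil: "bilinear \<Omega>"
    using bb by (rule bounded_bilinear_imp_bilinear)
  have lin1: "linear (\<lambda>x. \<Omega> x y)" and lin2: "linear (\<Omega> x)" for x y
    using bil by (auto simp: bilinear_def)
  note sm = linear_diff[OF lin1] linear_diff[OF lin2] linear_add[OF lin1] linear_add[OF lin2]
    linear_scale[OF lin1] linear_scale[OF lin2] linear_0[OF lin1] linear_0[OF lin2]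
    linear_neg[OF lin1] linear_neg[OF lin2] linear_sum[OF lin1] linear_sum[OF lin2]
  note skew = skew_symmetric_wrtD[OF S(3) bil]
  define Z where "Z = span (d ` B)"
  have Z: "subspace Z"
    by (simp add: Z_def)
  define g where "g s = (\<Sum>b\<in>B. \<Omega> (fst s) (d b) *\<^sub>R d b)" for s :: "'a \<times> 'b"
  have F: "bordered \<Omega> B d (s, z) = (snd s + z, g s)" for s z
    by (simp add: bordered_def g_def split: prod.split)
  have ling: "linear g"
    by (rule linearI) (simp_all add: g_def sm scaleR_add_left sum.distrib scaleR_sum_right)
  have solve: "\<exists>s\<in>S. \<exists>z\<in>Z. snd s + z = y \<and> g s = z'" if "z' \<in> Z" for y z'
  proof -
    have "(y, z') \<in> bordered \<Omega> B d ` (S \<times> Z)"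
      using bij that by (auto simp: bij_betw_def Z_def)
    then obtain s z where "s \<in> S" "z \<in> Z" "(y, z') = bordered \<Omega> B d (s, z)"
      by blast
    then show ?thesis
      unfolding F by blast
  qed
  have zero: "s = 0" if "s \<in> S" "snd s \<in> Z" "g s = 0" for s
  proof -
    have "bordered \<Omega> B d (s, - snd s) = bordered \<Omega> B d (0, 0)"
      using that linear_0[OF ling] by (simp add: F)
    moreover have "(s, - snd s) \<in> S \<times> Z" "(0, 0) \<in> S \<times> Z"
      using that S(1) Z by (auto simp: subspace_neg subspace_0)
    ultimately show ?thesis
      using bij unfolding bij_betw_def Z_def by (metis inj_onD prod.inject)
  qed
  \<comment> \<open>An element \<open>s\<close> of \<open>S\<close> lies in \<open>P\<close> iff
    some \<open>z\<close> in \<open>Z\<close> gives \<open>snd s + z = 0\<close>. Bijectivity of the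
    bordered map therefore makes \<open>g\<close> an isomorphism from \<open>P\<close> onto
    \<open>Z\<close>.\<close>
  define P where "P = {s \<in> S. snd s \<in> Z}"
  have P: "subspace P"
    using S(1) Z by (auto simp: P_def subspace_def)
  have "inj_on g P"
  proof (rule inj_onI)
    fix s t assume "s \<in> P" "t \<in> P" "g s = g t"
    then show "s = t"
      using zero[of "s - t"] S(1) Z by (simp add: P_def linear_diff[OF ling] subspace_diff)
  qed
  moreover have gP: "g ` P = span (d ` B)"
  proof (intro subset_antisym subsetI)
    show "w \<in> span (d ` B)" if "w \<in> g ` P" for w
      using that unfolding g_def by (clarify, intro span_sum span_scale span_base imageI)
    fix w assume "w \<in> span (d ` B)"
    then obtain s z where "s \<in> S" "z \<in> Z" "snd s + z = 0" "g s = w"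
      using solve[of w 0] by (auto simp: Z_def)
    moreover from this have "snd s \<in> Z"
      using Z by (metis eq_neg_iff_add_eq_0 subspace_neg)
    ultimately show "w \<in> g ` P"
      by (auto simp: P_def)
  qed
  ultimately have finP: "finite_dim P" and "dim P = dim (span (d ` B))"
    using finite_dim_linear_inj_on[OF ling _ P, of "d ` B"] fin by auto
  then have dimP: "dim P = card B"
    using d dim_span_eq_card_independent[OF d(2)] by (simp add: card_image)
  \<comment> \<open>Choose \<open>v\<close> in \<open>P\<close> with \<open>g v = z\<close>. By
    independence the numbers \<open>\<Omega> (fst v) (d b)\<close> are the coordinates of
    \<open>z\<close>, so \<open>\<Omega> (fst v) z\<close> is the sum of their squares.\<close>
  have nondeg: "z = 0" if z: "z \<in> Z" "\<And>v. v \<in> P \<Longrightarrow> \<Omega> (fst v) z = 0" for z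
  proof -
    obtain c where c: "z = (\<Sum>b\<in>B. c b *\<^sub>R d b)"
      using z(1) fin d(1) by (auto simp: Z_def span_finite sum.reindex)
    obtain v where v: "v \<in> P" "g v = z"
      using gP z(1) by (metis Z_def imageE)
    have "(\<Sum>b\<in>B. (\<Omega> (fst v) (d b) - c b) *\<^sub>R d b) = 0"
      using v(2) c by (simp add: g_def scaleR_diff_left sum_subtractf)
    then have sum0: "(\<Sum>w\<in>d ` B. (\<Omega> (fst v) w - c (inv_into B d w)) *\<^sub>R w) = 0"
      using d(1) by (simp add: sum.reindex inv_into_f_f)
    have eq: "\<Omega> (fst v) (d b) = c b" if "b \<in> B" for b
      using independentD[OF d(2) finite_imageI[OF fin] order_refl sum0 imageI[OF that]] d(1) that
      by (simp add: inv_into_f_f)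
    have "\<Omega> (fst v) z = (\<Sum>b\<in>B. c b * c b)"
      unfolding c sm by (rule sum.cong) (use eq in auto)
    then have "(\<Sum>b\<in>B. c b * c b) = 0"
      using z(2)[OF v(1)] by simp
    then have "c b = 0" if "b \<in> B" for b
      using that fin by (subst (asm) sum_nonneg_eq_0_iff) auto
    then show ?thesis
      by (simp add: c)
  qed
  define \<beta> where "\<beta> s t = \<Omega> (fst s) (snd t)" for s t :: "'a \<times> 'b"
  have \<beta>: "bilinear \<beta>"
    unfolding bilinear_def \<beta>_def by (auto intro!: linearI simp: sm)
  have alt: "\<beta> s s = 0" if "s \<in> P" for s
    using that skew[of "fst s" "snd s" "fst s" "snd s"] by (simp add: P_def \<beta>_def)
  define K where "K = rel_ker S"
  have K: "subspace K"
    using S(1) by (simp add: K_def rel_ker_subspace)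
  \<comment> \<open>For \<open>s\<close> in the radical, skew symmetry moves the vanishing to
    \<open>\<Omega> (fst t) (snd s)\<close>. As \<open>snd s\<close> lies in \<open>Z\<close>,
    \<open>nondeg\<close> forces it to be 0.\<close>
  have rad: "{s \<in> P. \<forall>t\<in>P. \<beta> s t = 0} = (\<lambda>x. (x, 0 :: 'b)) ` K"
  proof (intro subset_antisym subsetI)
    fix s assume "s \<in> {s \<in> P. \<forall>t\<in>P. \<beta> s t = 0}"
    then have s: "s \<in> P" and "\<And>t. t \<in> P \<Longrightarrow> \<Omega> (fst s) (snd t) = 0"
      by (simp_all add: \<beta>_def)
    then have "\<Omega> (fst t) (snd s) = 0" if "t \<in> P" for t
      using that skew[of "fst t" "snd t" "fst s" "snd s"] by (simp add: P_def)
    then have "snd s = 0"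
      using s nondeg by (simp add: P_def)
    then have "s = (fst s, 0)"
      by (simp add: prod_eq_iff)
    then show "s \<in> (\<lambda>x. (x, 0 :: 'b)) ` K"
      using s unfolding P_def K_def rel_ker_def by (metis (mono_tags, lifting) image_eqI mem_Collect_eq)
  next
    fix s assume "s \<in> (\<lambda>x. (x, 0 :: 'b)) ` K"
    then obtain x where x: "s = (x, 0)" "(x, 0) \<in> S"
      by (auto simp: K_def rel_ker_def)
    have "\<Omega> x (snd t) = 0" if "t \<in> P" for t
      using that x(2) skew[of x 0 "fst t" "snd t"] by (simp add: P_def sm)
    then show "s \<in> {s \<in> P. \<forall>t\<in>P. \<beta> s t = 0}"
      using x subspace_0[OF Z] by (auto simp: P_def \<beta>_def)
  qed
  note reduction = alternating_form_radical[OF \<beta> finP alt, unfolded rad]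
  obtain R where R: "finite R" "independent R" "span R = (\<lambda>x. (x, 0 :: 'b)) ` K"
  proof (rule finite_dim_subspace[OF finP])
    have lin: "linear (\<lambda>x. (x, 0 :: 'b))"
      by (rule linearI) auto
    show "subspace ((\<lambda>x. (x, 0 :: 'b)) ` K)"
      using linear_subspace_image[OF lin K] .
    show "(\<lambda>x. (x, 0 :: 'b)) ` K \<subseteq> P"
      unfolding rad[symmetric] by blast
  qed
  have "inj_on (\<lambda>x. (x, 0 :: 'b)) K"
    by (auto simp: inj_on_def)
  with R have finK: "finite_dim K" and dimK: "dim K = dim ((\<lambda>x. (x, 0 :: 'b)) ` K)"
    using finite_dim_linear_inj_on[of "\<lambda>x. (x, 0 :: 'b)" K R] K
    by (auto simp: linear_iff)
  have parity: "[dim K = card B] (mod 2)"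
    using reduction dimK dimP by simp
  have im: "rel_im S = {y. \<forall>x\<in>K. \<Omega> x y = 0}"
  proof (intro subset_antisym subsetI)
    fix y assume "y \<in> rel_im S"
    then obtain x' where "(x', y) \<in> S"
      by (auto simp: rel_im_def)
    then show "y \<in> {y. \<forall>x\<in>K. \<Omega> x y = 0}"
      using skew[of _ 0 x' y] by (auto simp: K_def rel_ker_def sm)
  next
    fix y assume y: "y \<in> {y. \<forall>x\<in>K. \<Omega> x y = 0}"
    \<comment> \<open>Split \<open>y = snd s + z\<close>. Pairing with \<open>z\<close> vanishes on
      the radical, since \<open>y\<close> and \<open>snd s\<close> annihilate \<open>K\<close>, so
      it is represented by some \<open>t\<close> in \<open>P\<close>. Then \<open>nondeg\<close>
      gives \<open>z = snd t\<close>, which puts \<open>y\<close> in the image.\<close>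
    obtain s z where s: "s \<in> S" "z \<in> Z" "snd s + z = y"
      using solve[OF subspace_0[OF Z], of y] by blast
    have "linear (\<lambda>t. \<Omega> (fst t) z)"
      by (rule linearI) (auto simp: sm)
    moreover have "\<forall>r\<in>(\<lambda>x. (x, 0 :: 'b)) ` K. \<Omega> (fst r) z = 0"
    proof clarsimp
      fix x assume x: "x \<in> K"
      have "\<Omega> x (snd s) = 0"
        using x s(1) skew[of x 0 "fst s" "snd s"] by (simp add: K_def rel_ker_def sm)
      moreover have "\<Omega> x (snd s + z) = 0"
        using x y s(3) by simp
      ultimately show "\<Omega> x z = 0"
        by (simp add: sm)
    qed
    ultimately obtain t where t: "t \<in> P" "\<forall>v\<in>P. \<Omega> (fst v) z = \<beta> v t"
      using reduction by blast
    have "z - snd t = 0"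
    proof (rule nondeg)
      show "z - snd t \<in> Z"
        using s(2) t(1) Z by (simp add: P_def subspace_diff)
      show "\<Omega> (fst v) (z - snd t) = 0" if "v \<in> P" for v
        using t(2) that by (simp add: \<beta>_def sm)
    qed
    then have "y = snd (s + t)" "s + t \<in> S"
      using s t(1) S(1) by (auto simp: P_def subspace_add)
    then show "y \<in> rel_im S"
      by (metis (mono_tags, lifting) mem_Collect_eq prod.collapse rel_im_def)
  qed
  obtain E where E: "finite E" "independent E" "span E = K" "card E = dim K"
    using finite_dim_subspace[OF finK K] by blast
  \<comment> \<open>Vectors dual to a basis of the kernel turn the description of the image into
    \<open>codim (rel_im S) = dim K\<close>.\<close>
  have "\<exists>w. \<forall>b\<in>E. w b \<in> UNIV \<and> (\<forall>a\<in>E. \<Omega> a (w b) = (if a = b then 1 else 0))"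
    by (rule dual_basis_exists[OF bil _ E(1,2)]) (use nd in \<open>auto simp: nondegenerate_def\<close>)
  then obtain w where w: "\<And>a b. a \<in> E \<Longrightarrow> b \<in> E \<Longrightarrow> \<Omega> a (w b) = (if a = b then 1 else 0)"
    by blast
  note ann = quotient_basis_annihilator[OF bil E(1) w, unfolded E(3), folded im]
  have "closed (rel_im S)"
  proof -
    have "rel_im S = (\<Inter>x\<in>K. \<Omega> x -` {0})"
      by (auto simp: im)
    moreover have "closed (\<Omega> x -` {0})" for x
      using bounded_bilinear.bounded_linear_right[OF bb]
      by (intro continuous_closed_vimage closed_singleton) (simp add: linear_continuous_at)
    ultimately show ?thesis
      by auto
  qed
  moreover have "finite_codim (rel_im S)"
    using ann(1) by (auto simp: finite_codim_def)
  moreover have "codim (rel_im S) = dim K"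
    using codim_eq_card[OF rel_im_subspace[OF S(1)] ann(1)] ann(2) E(4) by simp
  moreover have "skew_adjoint_wrt \<Omega> S"
    unfolding skew_adjoint_wrt_def
  proof (intro subset_antisym subsetI)
    show "p \<in> form_adjoint \<Omega> S" if "p \<in> neg_relation S" for p
      using that S(3) by (auto simp: skew_symmetric_wrt_def)
    fix p assume "p \<in> form_adjoint \<Omega> S"
    moreover obtain x' y' where p: "p = (x', y')"
      by (cases p)
    ultimately have adj: "\<Omega> x y' = \<Omega> x' y" if "(x, y) \<in> S" for x y
      using that by (auto simp: form_adjoint_def)
    \<comment> \<open>Testing the adjoint condition on pairs \<open>(x, 0)\<close> shows that
      \<open>y'\<close> annihilates the kernel.\<close>
    have "- y' \<in> rel_im S"
      using adj[of _ 0] by (auto simp: im K_def rel_ker_def sm)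
    then obtain x'' where x'': "(x'', - y') \<in> S"
      by (auto simp: rel_im_def)
    define u where "u = x' - x''"
    have u: "\<Omega> u y = 0" if y: "y \<in> rel_im S" for y
    proof -
      obtain x where x: "(x, y) \<in> S"
        using y by (auto simp: rel_im_def)
      show ?thesis
        using adj[OF x] skew[OF x x''] by (simp add: u_def sm)
    qed
    \<comment> \<open>\<open>u\<close> annihilates the image of \<open>S\<close>. Subtracting
      \<open>k\<close>, which has the same values on the dual vectors \<open>w a\<close>, leaves a
      vector annihilating the whole space, so \<open>u = k\<close> lies in the kernel by
      nondegeneracy.\<close>
    define k where "k = (\<Sum>a\<in>E. \<Omega> u (w a) *\<^sub>R a)"
    have "\<Omega> (u - k) y = 0" for y
    proof -
      have "y - (\<Sum>a\<in>E. \<Omega> a y *\<^sub>R w a) \<in> rel_im S"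
        using ann(3) by (simp add: im)
      then have "\<Omega> u (y - (\<Sum>a\<in>E. \<Omega> a y *\<^sub>R w a)) = 0"
        by (rule u)
      then show ?thesis
        by (simp add: k_def sm mult.commute)
    qed
    then have "u - k = 0"
      using nd unfolding nondegenerate_def by blast
    moreover have "k \<in> K"
      unfolding k_def E(3)[symmetric] by (intro span_sum span_scale span_base)
    ultimately have "(u, 0) \<in> S"
      by (simp add: K_def rel_ker_def)
    then have "(u, 0) + (x'', - y') \<in> S"
      using x'' S(1) by (intro subspace_add)
    then have "(x', - y') \<in> S"
      by (simp add: u_def)
    then show "p \<in> neg_relation S"
      unfolding p neg_relation_def by force
  qed
  ultimately show ?thesis
    using S(1,2) finK parity by (simp add: fredholm_relation_def fredholm_index_def K_def)
qed

section \<open>Bordering the unperturbed relation\<close>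

lemma independent_quotient_basis:
  assumes "subspace V" "quotient_basis V B"
  shows "independent B"
proof -
  have B: "finite B" "\<And>c. (\<Sum>b\<in>B. c b *\<^sub>R b) \<in> V \<Longrightarrow> \<forall>b\<in>B. c b = 0"
    using assms(2) by (auto simp: quotient_basis_def)
  show ?thesis
    unfolding dependent_finite[OF B(1)] using B(2) subspace_0[OF assms(1)] by force
qed

text \<open>By skew symmetry \<open>ker T\<close> annihilates \<open>im T\<close>, so it pairs
  nondegenerately with any complement of the image. Index 0 makes the dimensions of kernel and
  complement equal, so the dual vectors fill the whole complement.\<close>

lemma skew_fredholm_bordering:
  fixes \<Omega> :: "'a::real_normed_vector \<Rightarrow> 'b::real_normed_vector \<Rightarrow> real"
  assumes bil: "bilinear \<Omega>" and nd: "nondegenerate \<Omega>"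
    and T: "fredholm_relation T" "fredholm_index T = 0" "skew_symmetric_wrt \<Omega> T"
  obtains B d where "finite B" "card B = dim (rel_ker T)" "inj_on d B" "independent (d ` B)"
    "\<And>a b. a \<in> B \<Longrightarrow> b \<in> B \<Longrightarrow> \<Omega> a (d b) = (if a = b then 1 else 0)"
    "bij_betw (bordered \<Omega> B d) (T \<times> span (d ` B)) (UNIV \<times> span (d ` B))"
proof -
  have lin1: "linear (\<lambda>x. \<Omega> x y)" and lin2: "linear (\<Omega> x)" for x y
    using bil by (auto simp: bilinear_def)
  note sm = linear_diff[OF lin1] linear_diff[OF lin2] linear_add[OF lin1] linear_add[OF lin2]
    linear_scale[OF lin1] linear_scale[OF lin2] linear_0[OF lin1] linear_0[OF lin2]
    linear_neg[OF lin1] linear_neg[OF lin2] linear_sum[OF lin1] linear_sum[OF lin2]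
  note skew = skew_symmetric_wrtD[OF T(3) bil]
  define K where "K = rel_ker T"
  have sT: "subspace T" and finK: "finite_dim K" and codim: "finite_codim (rel_im T)"
    using T(1) by (auto simp: fredholm_relation_def K_def)
  have K: "subspace K"
    using sT by (simp add: K_def rel_ker_subspace)
  have im: "subspace (rel_im T)"
    using sT by (rule rel_im_subspace)
  have K_im: "\<Omega> x y = 0" if "x \<in> K" "y \<in> rel_im T" for x y
    using that skew[of x 0 _ y] by (auto simp: K_def rel_ker_def rel_im_def sm)
  obtain B where B: "finite B" "independent B" "span B = K" "card B = dim K"
    using finite_dim_subspace[OF finK K] by blast
  obtain C where C: "quotient_basis (rel_im T) C"
    using codim by (auto simp: finite_codim_def)
  have finC: "finite C" and spanC: "\<And>y. \<exists>c. y - (\<Sum>b\<in>C. c b *\<^sub>R b) \<in> rel_im T"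
    using C by (auto simp: quotient_basis_def)
  have decomp: "\<exists>z\<in>span C. y - z \<in> rel_im T" for y
  proof -
    obtain c where "y - (\<Sum>b\<in>C. c b *\<^sub>R b) \<in> rel_im T"
      using spanC by blast
    moreover have "(\<Sum>b\<in>C. c b *\<^sub>R b) \<in> span C"
      by (intro span_sum span_scale span_base)
    ultimately show ?thesis
      by blast
  qed
  have card: "card C = card B"
    using T(2) codim_eq_card[OF im C] B(4) by (simp add: fredholm_index_def K_def)
  \<comment> \<open>Such an \<open>x\<close> annihilates the image and the complement
    \<open>span C\<close>, hence everything.\<close>
  have nondeg: "x = 0" if "x \<in> span B" "\<forall>z\<in>span C. \<Omega> x z = 0" for x
  proof -
    have "\<Omega> x y = 0" for y
    proof -
      obtain z where z: "z \<in> span C" "y - z \<in> rel_im T"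
        using decomp by blast
      have "\<Omega> x (y - z) = 0"
        using K_im that(1) z(2) B(3) by blast
      then show ?thesis
        using that(2) z(1) by (simp add: sm)
    qed
    then show ?thesis
      using nd unfolding nondegenerate_def by blast
  qed
  have "\<exists>d. \<forall>b\<in>B. d b \<in> span C \<and> (\<forall>a\<in>B. \<Omega> a (d b) = (if a = b then 1 else 0))"
    using nondeg by (intro dual_basis_exists[OF bil subspace_span B(1,2)])
  then obtain d where dC: "\<And>b. b \<in> B \<Longrightarrow> d b \<in> span C"
    and dual: "\<And>a b. a \<in> B \<Longrightarrow> b \<in> B \<Longrightarrow> \<Omega> a (d b) = (if a = b then 1 else 0)"
    by metis
  note ann = quotient_basis_annihilator[OF bil B(1) dual]
  have inj: "inj_on d B"
    using B(1) ann(2) by (rule eq_card_imp_inj_on)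
  have "subspace {y. \<forall>x\<in>span B. \<Omega> x y = 0}"
    by (auto simp: subspace_def sm)
  then have ind: "independent (d ` B)"
    using ann(1) by (rule independent_quotient_basis)
  define Z where "Z = span (d ` B)"
  have Z: "subspace Z"
    by (simp add: Z_def)
  \<comment> \<open>Dimension count: the dual vectors are \<open>card C\<close> independent elements
    of \<open>span C\<close>, so no further element of \<open>C\<close> can be independent of
    them.\<close>
  have "C \<subseteq> Z"
  proof (rule subsetI, rule ccontr)
    fix c assume c: "c \<in> C" "c \<notin> Z"
    have "independent (insert c (d ` B))"
      using c(2) ind by (simp add: Z_def independent_insertI)
    moreover have "insert c (d ` B) \<subseteq> span C"
      using c(1) dC by (auto intro: span_base)
    ultimately have "card (insert c (d ` B)) \<le> card C"
      using independent_span_bound[OF finC] by blast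
    moreover have "c \<notin> d ` B"
      using c(2) span_superset[of "d ` B"] by (auto simp: Z_def)
    ultimately show False
      using B(1) card ann(2) by simp
  qed
  then have CZ: "span C = Z"
    using dC unfolding Z_def by (intro subset_antisym span_minimal subspace_span) auto
  have expand: "z = (\<Sum>b\<in>B. \<Omega> b z *\<^sub>R d b)" if z: "z \<in> Z" for z
  proof -
    obtain c where c: "z = (\<Sum>b\<in>B. c b *\<^sub>R d b)"
      using z B(1) inj by (auto simp: Z_def span_finite sum.reindex)
    then have "\<Omega> b z = c b" if "b \<in> B" for b
      using ann(4) that by simp
    then show ?thesis
      unfolding c by (intro sum.cong) auto
  qed
  have coef: "\<Omega> (\<Sum>a\<in>B. c a *\<^sub>R a) (d b) = c b" if "b \<in> B" for c b
  proof -
    have "\<Omega> (\<Sum>a\<in>B. c a *\<^sub>R a) (d b) = (\<Sum>a\<in>B. if a = b then c a else 0)"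
      unfolding sm by (rule sum.cong) (use that dual in auto)
    then show ?thesis
      using that B(1) by simp
  qed
  \<comment> \<open>Pairing \<open>y + z = 0\<close> with the kernel removes \<open>y\<close> and
    shows that the coordinates of \<open>z\<close> vanish. Then \<open>x\<close> is in the kernel
    and annihilates the complement.\<close>
  have zero: "x = 0 \<and> y = 0 \<and> z = 0"
    if "(x, y) \<in> T" "z \<in> Z" "y + z = 0" "(\<Sum>b\<in>B. \<Omega> x (d b) *\<^sub>R d b) = 0" for x y z
  proof -
    have "\<Omega> b z = 0" if "b \<in> B" for b
    proof -
      have "\<Omega> b y = 0"
        using K_im[of b y] that \<open>(x, y) \<in> T\<close> B(3) span_base[OF that] by (auto simp: rel_im_def)
      moreover have "\<Omega> b (y + z) = 0"
        using \<open>y + z = 0\<close> by (simp add: sm)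
      ultimately show ?thesis
        by (simp add: sm)
    qed
    then have z: "z = 0"
      by (subst expand[OF \<open>z \<in> Z\<close>]) simp
    then have x: "x \<in> span B"
      using that B(3) by (simp add: K_def rel_ker_def)
    have xd: "\<Omega> x (d b) = 0" if "b \<in> B" for b
      using ann(4)[where a = b and c = "\<lambda>b. \<Omega> x (d b)"] that
        \<open>(\<Sum>b\<in>B. \<Omega> x (d b) *\<^sub>R d b) = 0\<close> by (simp add: linear_0[OF lin2])
    have "\<Omega> x w = 0" if "w \<in> Z" for w
      by (subst expand[OF that]) (simp add: sm xd)
    then have "\<forall>w\<in>span C. \<Omega> x w = 0"
      by (simp add: CZ)
    then show ?thesis
      using nondeg[OF x] z that(3) by simp
  qed
  have "inj_on (bordered \<Omega> B d) (T \<times> Z)"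
  proof (rule inj_onI)
    fix p q assume pq: "p \<in> T \<times> Z" "q \<in> T \<times> Z" "bordered \<Omega> B d p = bordered \<Omega> B d q"
    obtain x y z x' y' z' where eq: "p = ((x, y), z)" "q = ((x', y'), z')"
      by (metis prod.exhaust)
    have "x - x' = 0 \<and> y - y' = 0 \<and> z - z' = 0"
    proof (rule zero)
      show "(x - x', y - y') \<in> T"
        using pq(1,2) subspace_diff[OF sT, of "(x, y)" "(x', y')"] by (simp add: eq)
      show "z - z' \<in> Z"
        using pq(1,2) Z by (simp add: eq subspace_diff)
      show "(y - y') + (z - z') = 0"
        using pq(3) by (simp add: eq bordered_def algebra_simps)
      show "(\<Sum>b\<in>B. \<Omega> (x - x') (d b) *\<^sub>R d b) = 0"
        using pq(3) by (simp add: eq bordered_def linear_diff[OF lin1] scaleR_diff_left sum_subtractf)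
    qed
    then show "p = q"
      by (simp add: eq)
  qed
  moreover have "bordered \<Omega> B d ` (T \<times> Z) = UNIV \<times> Z"
  proof (intro subset_antisym subsetI)
    fix p assume "p \<in> bordered \<Omega> B d ` (T \<times> Z)"
    moreover have "(\<Sum>b\<in>B. \<Omega> x (d b) *\<^sub>R d b) \<in> Z" for x
      unfolding Z_def by (intro span_sum span_scale span_base imageI)
    ultimately show "p \<in> UNIV \<times> Z"
      by (auto simp: bordered_def)
  next
    fix p :: "'b \<times> 'b" assume "p \<in> UNIV \<times> Z"
    then obtain w z' where p: "p = (w, z')" "z' \<in> Z"
      by blast
    obtain z x where z: "z \<in> Z" "(x, w - z) \<in> T"
      using decomp[of w] unfolding CZ by (auto simp: rel_im_def)
    \<comment> \<open>A decomposition of \<open>w\<close> solves the first component. Adding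
      \<open>k\<close> from the kernel keeps it and adjusts the pairings with \<open>d b\<close> to
      the coordinates of \<open>z'\<close>.\<close>
    define k where "k = (\<Sum>a\<in>B. (\<Omega> a z' - \<Omega> x (d a)) *\<^sub>R a)"
    have "k \<in> K"
      unfolding k_def B(3)[symmetric] by (intro span_sum span_scale span_base)
    then have "(x, w - z) + (k, 0) \<in> T"
      using z(2) sT by (intro subspace_add) (auto simp: K_def rel_ker_def)
    then have "((x + k, w - z), z) \<in> T \<times> Z"
      using z(1) by simp
    moreover have "(\<Sum>b\<in>B. \<Omega> (x + k) (d b) *\<^sub>R d b) = z'"
    proof -
      have "\<Omega> (x + k) (d b) = \<Omega> b z'" if "b \<in> B" for b
        using coef[OF that, of "\<lambda>a. \<Omega> a z' - \<Omega> x (d a)"] by (simp add: linear_add[OF lin1] k_def)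
      then have "(\<Sum>b\<in>B. \<Omega> (x + k) (d b) *\<^sub>R d b) = (\<Sum>b\<in>B. \<Omega> b z' *\<^sub>R d b)"
        by (intro sum.cong) auto
      then show ?thesis
        using expand[OF p(2)] by metis
    qed
    then have "bordered \<Omega> B d ((x + k, w - z), z) = p"
      by (simp add: bordered_def p)
    ultimately show "p \<in> bordered \<Omega> B d ` (T \<times> Z)"
      by (metis image_eqI)
  qed
  ultimately have "bij_betw (bordered \<Omega> B d) (T \<times> Z) (UNIV \<times> Z)"
    by (simp add: bij_betw_def)
  then show thesis
    using that[of B d] B(1,4) inj ind dual by (simp add: Z_def K_def)
qed

section \<open>Continuity of the bordered map\<close>

text \<open>The dual functionals are continuous coordinates, so the span is the fixed point set of a
  continuous projection.\<close>

lemma closed_span_dual: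
  fixes \<Omega> :: "'a::real_normed_vector \<Rightarrow> 'b::real_normed_vector \<Rightarrow> real"
  assumes bb: "bounded_bilinear \<Omega>" and fin: "finite B"
    and dual: "\<And>a b. a \<in> B \<Longrightarrow> b \<in> B \<Longrightarrow> \<Omega> a (d b) = (if a = b then 1 else 0)"
  shows "closed (span (d ` B))"
proof -
  have "span (d ` B) = {z. z = (\<Sum>b\<in>B. \<Omega> b z *\<^sub>R d b)}"
  proof (intro subset_antisym subsetI CollectI)
    have bil: "bilinear \<Omega>"
      using bb by (rule bounded_bilinear_imp_bilinear)
    note ann = quotient_basis_annihilator[OF bil fin dual]
    fix z assume "z \<in> span (d ` B)"
    then obtain c where c: "z = (\<Sum>b\<in>B. c b *\<^sub>R d b)"
      using fin eq_card_imp_inj_on[OF fin ann(2)] by (auto simp: span_finite sum.reindex)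
    then have "\<Omega> b z = c b" if "b \<in> B" for b
      using ann(4) that by simp
    then show "z = (\<Sum>b\<in>B. \<Omega> b z *\<^sub>R d b)"
      unfolding c by (intro sum.cong) auto
  next
    fix z assume "z \<in> {z. z = (\<Sum>b\<in>B. \<Omega> b z *\<^sub>R d b)}"
    moreover have "(\<Sum>b\<in>B. \<Omega> b z *\<^sub>R d b) \<in> span (d ` B)"
      by (intro span_sum span_scale span_base imageI)
    ultimately show "z \<in> span (d ` B)"
      by simp
  qed
  moreover have "closed {z. z = (\<Sum>b\<in>B. \<Omega> b z *\<^sub>R d b)}"
    by (intro closed_Collect_eq continuous_intros bounded_linear.continuous_on[OF bounded_bilinear.bounded_linear_right[OF bb]])
  ultimately show ?thesis
    by simp
qed

lemma bounded_linear_bordered: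
  fixes \<Omega> :: "'a::real_normed_vector \<Rightarrow> 'b::real_normed_vector \<Rightarrow> real"
  assumes "bounded_bilinear \<Omega>"
  shows "bounded_linear (bordered \<Omega> B d)"
proof -
  have left: "bounded_linear (\<lambda>u :: ('a \<times> 'b) \<times> 'b. \<Omega> (fst (fst u)) y)" for y
    using bounded_linear_compose[OF bounded_bilinear.bounded_linear_left[OF assms]
        bounded_linear_compose[OF bounded_linear_fst bounded_linear_fst]] .
  have "bounded_linear (\<lambda>u :: ('a \<times> 'b) \<times> 'b. \<Omega> (fst (fst u)) y *\<^sub>R w)" for y w :: 'b
    using bounded_linear_compose[OF bounded_linear_scaleR_left left] .
  then have "bounded_linear (\<lambda>u :: ('a \<times> 'b) \<times> 'b. (snd (fst u) + snd u, \<Sum>b\<in>B. \<Omega> (fst (fst u)) (d b) *\<^sub>R d b))"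
    by (intro bounded_linear_Pair bounded_linear_add bounded_linear_sum
        bounded_linear_compose[OF bounded_linear_snd bounded_linear_fst] bounded_linear_snd)
  moreover have "bordered \<Omega> B d = (\<lambda>u. (snd (fst u) + snd u, \<Sum>b\<in>B. \<Omega> (fst (fst u)) (d b) *\<^sub>R d b))"
    by (auto simp: bordered_def split: prod.split)
  ultimately show ?thesis
    by simp
qed

text \<open>Only the coefficients \<open>\<Omega> x (d b)\<close> depend on the form. Each
  contributes one factor \<open>norm (d b)\<close> as an argument of the form and one as the vector
  it multiplies.\<close>

lemma bordered_perturbation:
  assumes "bounded_bilinear \<Omega>" "bounded_bilinear \<Omega>0"
  shows "norm (bordered \<Omega> B d u - bordered \<Omega>0 B d u)
    \<le> norm (form_map \<Omega> - form_map \<Omega>0) * (\<Sum>b\<in>B. norm (d b) * norm (d b)) * norm u"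
proof -
  obtain x y z where u: "u = ((x, y), z)"
    by (metis prod.exhaust)
  let ?\<eta> = "norm (form_map \<Omega> - form_map \<Omega>0)"
  have "bordered \<Omega> B d u - bordered \<Omega>0 B d u = (0, \<Sum>b\<in>B. (\<Omega> x (d b) - \<Omega>0 x (d b)) *\<^sub>R d b)"
    by (simp add: u bordered_def scaleR_diff_left sum_subtractf)
  also have "norm \<dots> = norm (\<Sum>b\<in>B. (\<Omega> x (d b) - \<Omega>0 x (d b)) *\<^sub>R d b)"
    by simp
  also have "\<dots> \<le> (\<Sum>b\<in>B. \<bar>\<Omega> x (d b) - \<Omega>0 x (d b)\<bar> * norm (d b))"
    by (rule order_trans[OF norm_sum]) simp
  also have "\<dots> \<le> (\<Sum>b\<in>B. (?\<eta> * norm x * norm (d b)) * norm (d b))"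
  proof (intro sum_mono mult_right_mono norm_ge_zero)
    fix b
    have "\<Omega> x (d b) - \<Omega>0 x (d b) = (form_map \<Omega> - form_map \<Omega>0) x (d b)"
      by (simp add: blinfun.diff_left form_map_apply assms)
    also have "norm \<dots> \<le> norm ((form_map \<Omega> - form_map \<Omega>0) x) * norm (d b)"
      by (rule norm_blinfun)
    also have "\<dots> \<le> ?\<eta> * norm x * norm (d b)"
      by (intro mult_right_mono norm_blinfun norm_ge_zero)
    finally show "\<bar>\<Omega> x (d b) - \<Omega>0 x (d b)\<bar> \<le> ?\<eta> * norm x * norm (d b)"
      by simp
  qed
  also have "\<dots> = ?\<eta> * (\<Sum>b\<in>B. norm (d b) * norm (d b)) * norm x"
    by (simp add: sum_distrib_left sum_distrib_right mult_ac)
  also have "norm x \<le> norm u"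
    unfolding u using norm_fst_le[of x y] norm_fst_le[of "(x, y)" z] by linarith
  finally show ?thesis
    by (simp add: mult_left_mono sum_nonneg)
qed

section \<open>Choice of the constants and conclusion\<close>

theorem theorem1p3:
  fixes \<Omega>0 :: "'a::banach \<Rightarrow> 'b::banach \<Rightarrow> real"
    and T :: "('a \<times> 'b) set"
  assumes "bounded_bilinear \<Omega>0" and "nondegenerate \<Omega>0"
    and "fredholm_relation T" and "fredholm_index T = 0"
    and "skew_adjoint_wrt \<Omega>0 T"
  shows "\<exists>\<delta>>0. \<forall>(\<Omega> :: 'a \<Rightarrow> 'b \<Rightarrow> real) (S :: ('a \<times> 'b) set).
           bounded_bilinear \<Omega> \<and> nondegenerate \<Omega> \<and>
           subspace S \<and> closed S \<and> skew_symmetric_wrt \<Omega> S \<and>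
           gap S T + norm (form_map \<Omega> - form_map \<Omega>0) < \<delta> \<longrightarrow>
           fredholm_relation S \<and> fredholm_index S = 0 \<and> skew_adjoint_wrt \<Omega> S \<and>
           [dim (rel_ker S) = dim (rel_ker T)] (mod 2)"
proof -
  have T: "subspace T" "closed T"
    using assms(3) by (auto simp: fredholm_relation_def)
  have "skew_symmetric_wrt \<Omega>0 T"
    using assms(5) by (simp add: skew_symmetric_wrt_def skew_adjoint_wrt_def)
  then obtain B d where B: "finite B" "card B = dim (rel_ker T)" "inj_on d B" "independent (d ` B)"
    and dual: "\<And>a b. a \<in> B \<Longrightarrow> b \<in> B \<Longrightarrow> \<Omega>0 a (d b) = (if a = b then 1 else 0)"
    and bij: "bij_betw (bordered \<Omega>0 B d) (T \<times> span (d ` B)) (UNIV \<times> span (d ` B))"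
    using skew_fredholm_bordering[OF bounded_bilinear_imp_bilinear[OF assms(1)] assms(2-4)] by blast
  define Z where "Z = span (d ` B)"
  have Z: "subspace Z" "closed Z"
    using closed_span_dual[where \<Omega> = \<Omega>0 and d = d, OF assms(1) B(1) dual] by (simp_all add: Z_def)
  have subspace_UZ: "subspace (UNIV \<times> Z :: ('b \<times> 'b) set)"
    using Z(1) by (intro subspace_Times subspace_UNIV)
  define F where "F \<Omega> = bordered \<Omega> B d" for \<Omega>
  have F: "bounded_linear (F \<Omega>)" if "bounded_bilinear \<Omega>" for \<Omega>
    using bounded_linear_bordered[OF that] by (simp add: F_def)
  have FT: "inj_on (F \<Omega>0) (T \<times> Z)" "F \<Omega>0 ` (T \<times> Z) = UNIV \<times> Z"
    using bij by (simp_all add: bij_betw_def F_def Z_def)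
  have "closed (F \<Omega>0 ` (T \<times> Z))"
    unfolding FT(2) using Z(2) by (intro closed_Times closed_UNIV)
  then obtain C where C: "0 < C" "\<And>u. u \<in> T \<times> Z \<Longrightarrow> norm u \<le> C * norm (F \<Omega>0 u)"
    using bounded_inverse_on[OF F[OF assms(1)] subspace_Times[OF T(1) Z(1)]
        closed_Times[OF T(2) Z(2)] _ FT(1)] by blast
  obtain K where K: "0 \<le> K" "\<And>u. norm (F \<Omega>0 u) \<le> K * norm u"
    using bounded_linear.nonneg_bounded[OF F[OF assms(1)]] by (metis mult.commute)
  define N where "N = (\<Sum>b\<in>B. norm (d b) * norm (d b))"
  have N: "0 \<le> N"
    by (simp add: N_def sum_nonneg)
  \<comment> \<open>The largest value allowed by the smallness condition of
    \<open>bij_betw_perturbation\<close>, with \<open>C\<close> bounding the inverse and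
    \<open>K\<close> the map itself.\<close>
  define \<epsilon> where "\<epsilon> = 1 / (2 * (1 + (K + 2) * C))"
  have "0 < 1 + (K + 2) * C"
    using C(1) K(1) by (simp add: add_pos_nonneg)
  then have \<epsilon>: "0 < \<epsilon>" "\<epsilon> * (1 + (K + 2) * C) \<le> 1 / 2"
    by (simp_all add: \<epsilon>_def)
  \<comment> \<open>With the bound \<open>\<epsilon> / (1 + N)\<close> both semigaps are below
    \<open>\<epsilon>\<close>, and the change of the bordered map, which is at most \<open>N\<close>
    times the distance of the forms, has norm at most \<open>\<epsilon>\<close>. The summand 1
    covers \<open>N = 0\<close>, as for trivial \<open>ker T\<close>.\<close>
  have "fredholm_relation S \<and> fredholm_index S = 0 \<and> skew_adjoint_wrt \<Omega> S \<and>
           [dim (rel_ker S) = dim (rel_ker T)] (mod 2)"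
    if \<Omega>: "bounded_bilinear \<Omega>" "nondegenerate \<Omega>"
      and S: "subspace S" "closed S" "skew_symmetric_wrt \<Omega> S"
      and small: "gap S T + norm (form_map \<Omega> - form_map \<Omega>0) < \<epsilon> / (1 + N)" for \<Omega> S
  proof -
    let ?\<eta> = "norm (form_map \<Omega> - form_map \<Omega>0)"
    have "\<epsilon> / (1 + N) \<le> \<epsilon>"
      using \<epsilon>(1) N by (simp add: field_simps)
    then have gap: "semigap S T < \<epsilon>" "semigap T S < \<epsilon>"
      using small norm_ge_zero[of "form_map \<Omega> - form_map \<Omega>0"] unfolding gap_def by linarith+
    have "?\<eta> \<le> \<epsilon> / (1 + N)"
      using small semigap_nonneg[OF S(1) T(1)] unfolding gap_def by linarith
    then have "?\<eta> * (1 + N) \<le> \<epsilon>"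
      using N by (simp add: pos_le_divide_eq)
    then have \<eta>: "?\<eta> * N \<le> \<epsilon>"
      by (simp add: distrib_left) (metis add_increasing norm_ge_zero order_refl order_trans)
    \<comment> \<open>The border component is kept, so approximation between the relations carries
      over to their products with \<open>Z\<close> with the same constant.\<close>
    have lift: "\<exists>e\<in>R \<times> Z. norm (u - e) \<le> \<epsilon> * norm u"
      if Q: "subspace Q" "subspace R" "semigap Q R < \<epsilon>" "u \<in> Q \<times> Z" for Q R and u :: "('a \<times> 'b) \<times> 'b"
    proof -
      obtain s z where u: "u = (s, z)" "s \<in> Q" "z \<in> Z"
        using Q(4) by blast
      obtain t where t: "t \<in> R" "norm (s - t) \<le> \<epsilon> * norm s"
        using gap_approximation[OF Q(1-3) u(2)] by blast
      have "norm (u - (t, z)) = norm (s - t)"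
        by (simp add: u)
      also have "\<dots> \<le> \<epsilon> * norm u"
        using t(2) mult_left_mono[OF norm_fst_le[of s z] less_imp_le[OF \<epsilon>(1)]] by (simp add: u)
      finally show ?thesis
        using t(1) u(3) by blast
    qed
    have FS: "F \<Omega> ` (S \<times> Z) \<subseteq> UNIV \<times> Z"
    proof -
      have "(\<Sum>b\<in>B. \<Omega> x (d b) *\<^sub>R d b) \<in> Z" for x
        unfolding Z_def by (intro span_sum span_scale span_base imageI)
      then show ?thesis
        by (auto simp: F_def bordered_def)
    qed
    have "bij_betw (F \<Omega>) (S \<times> Z) (UNIV \<times> Z)"
    proof (rule bij_betw_perturbation[OF F[OF assms(1)] F[OF \<Omega>(1)] subspace_Times[OF S(1) Z(1)]
          closed_Times[OF S(2) Z(2)] subspace_UZ FS FT(2) less_imp_le[OF C(1)] C(2) K])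
      show "norm (F \<Omega> u - F \<Omega>0 u) \<le> \<epsilon> * norm u" for u
        using order_trans[OF bordered_perturbation[OF \<Omega>(1) assms(1), of B d u]
            mult_right_mono[OF \<eta>[unfolded N_def] norm_ge_zero]] by (simp add: F_def)
    qed (use lift[OF S(1) T(1) gap(1)] lift[OF T(1) S(1) gap(2)] \<epsilon> in auto)
    then show ?thesis
      using bordered_skew_fredholm[OF \<Omega> S B(1,3,4)] B(2) by (simp add: F_def Z_def)
  qed
  moreover have "0 < \<epsilon> / (1 + N)"
    using \<epsilon>(1) N by simp
  ultimately show ?thesis
    by blast
qed

end
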